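(* Let $\Phi$ be a perfect operator category. The endofunctor $T$ on $\Phi$ is a monad with unit $\iota\colon\mathrm{id}_\Phi\to T$ and multiplication $\mu\colon T^2\to T$.
   Context: An operator category $\Phi$ is an essentially small category with a terminal object $1$, with finite morphism sets, such that for every morphism $J\to I$ and every point $i\in|I|:=\mathrm{Mor}_\Phi(1,I)$ (also written $\{i\}\to I$) the fiber $J_i:=\{i\}\times_I J$ exists. A point classifier for $\Phi$ is a terminal object $(T,t)$ of the category whose objects are pairs $(I,i)$ with $i\in|I|$ and whose morphisms $(I,i)\to(J,j)$ are morphisms $f\colon I\to J$ with $f\circ i=j$ such that $\{i\}$ is the fiber of $f$ over $j$ (i.e. the evident square is a pullback). The unique morphism $(I,i)\to(T,t)$ is denoted $\chi_i\colon I\to T$ and called the classifying morphism of $i$. The special fiber functor is $\mathrm{fib}\colon(\Phi/T)\to\Phi$, $(J\to T)\mapsto J_t$. $\Phi$ is perfect if it has a point classifier $(T,t)$ and $\mathrm{fib}$ admits a right adjoint $E$. Then $T\colon\Phi\to\Phi$ also denotes the composite of $E$ with the forgetful functor $(\Phi/T)\to\Phi$, and $E(I)$ is written $e_I\colon TI\to T$. Unit: the counit $\kappa_I\colon(TI)_t\to I$ of the adjunction $\mathrm{fib}\dashv E$ is an isomorphism, and $\iota_I\colon I\to TI$ is $\kappa_I^{-1}$ followed by the projection $(TI)_t\to TI$. Multiplication: regard $t$ as a point of $TT$ (that is, $T$ applied to the object $T$) via $\iota_T\colon T\to TT$, with classifying morphism $\chi_t\colon TT\to T$. For a morphism $\phi\colon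 J\to T$, the fiber over $t$ of $\chi_t\circ T(\phi)\colon TJ\to T$ is identified via $\iota_J$ with $J_t$; let $\sigma_J\colon TJ\to T(J_t)$ be the morphism over $T$ from $\chi_t\circ T(\phi)$ to $e_{J_t}$ adjoint to this identification. For $I\in\Phi$, applying this to $\phi=e_I\colon TI\to T$, define $\mu_I\colon T^2I\to TI$ as the composite $T^2I\xrightarrow{\sigma_{TI}}T((TI)_t)\xrightarrow{T(\kappa_I)}TI$. *)

theory Defs
  imports Main
begin

section \<open>Categories, functors, adjunctions, monads\<close>

record ('o, 'm) category =
  Obj :: "'o set"
  Arr :: "'m set"
  Dom :: "'m \<Rightarrow> 'o"
  Cod :: "'m \<Rightarrow> 'o"
  Id :: "'o \<Rightarrow> 'm"
  Comp :: "'m \<Rightarrow> 'm \<Rightarrow> 'm"  (infixr "\<cdot>\<index>" 70)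

definition hom :: "('o, 'm) category \<Rightarrow> 'o \<Rightarrow> 'o \<Rightarrow> 'm set" where
  "hom C a b = {f \<in> Arr C. Dom C f = a \<and> Cod C f = b}"

definition is_category :: "('o, 'm) category \<Rightarrow> bool" where
  "is_category C \<longleftrightarrow>
     (\<forall>f\<in>Arr C. Dom C f \<in> Obj C \<and> Cod C f \<in> Obj C) \<and>
     (\<forall>a\<in>Obj C. Id C a \<in> hom C a a) \<and>
     (\<forall>f\<in>Arr C. \<forall>g\<in>Arr C. Cod C f = Dom C g \<longrightarrow> g \<cdot>\<^bsub>C\<^esub> f \<in> hom C (Dom C f) (Cod C g)) \<and>
     (\<forall>f\<in>Arr C. f \<cdot>\<^bsub>C\<^esub> Id C (Dom C f) = f \<and> Id C (Cod C f) \<cdot>\<^bsub>C\<^esub> f = f) \<and>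
     (\<forall>f\<in>Arr C. \<forall>g\<in>Arr C. \<forall>h\<in>Arr C. Cod C f = Dom C g \<and> Cod C g = Dom C h \<longrightarrow>
        h \<cdot>\<^bsub>C\<^esub> (g \<cdot>\<^bsub>C\<^esub> f) = (h \<cdot>\<^bsub>C\<^esub> g) \<cdot>\<^bsub>C\<^esub> f)"

definition is_terminal :: "('o, 'm) category \<Rightarrow> 'o \<Rightarrow> bool" where
  "is_terminal C z \<longleftrightarrow> z \<in> Obj C \<and> (\<forall>a\<in>Obj C. \<exists>!f. f \<in> hom C a z)"

text \<open>Only meaningful when \<open>f\<close> is an isomorphism.\<close>

definition arr_inverse :: "('o, 'm) category \<Rightarrow> 'm \<Rightarrow> 'm" where
  "arr_inverse C f =
     (THE g. g \<in> hom C (Cod C f) (Dom C f) \<and>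
             g \<cdot>\<^bsub>C\<^esub> f = Id C (Dom C f) \<and> f \<cdot>\<^bsub>C\<^esub> g = Id C (Cod C f))"

text \<open>The square with \<open>p : P \<rightarrow> A\<close>, \<open>q : P \<rightarrow> B\<close> over \<open>f : A \<rightarrow> X\<close>, \<open>g : B \<rightarrow> X\<close>.\<close>

definition is_pullback :: "('o, 'm) category \<Rightarrow> 'm \<Rightarrow> 'm \<Rightarrow> 'm \<Rightarrow> 'm \<Rightarrow> bool" where
  "is_pullback C p q f g \<longleftrightarrow>
     p \<in> Arr C \<and> q \<in> Arr C \<and> f \<in> Arr C \<and> g \<in> Arr C \<and>
     Dom C p = Dom C q \<and> Cod C p = Dom C f \<and> Cod C q = Dom C g \<and> Cod C f = Cod C g \<and>
     f \<cdot>\<^bsub>C\<^esub> p = g \<cdot>\<^bsub>C\<^esub> q \<and>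
     (\<forall>u\<in>Arr C. \<forall>v\<in>Arr C.
        Dom C u = Dom C v \<and> Cod C u = Dom C f \<and> Cod C v = Dom C g \<and> f \<cdot>\<^bsub>C\<^esub> u = g \<cdot>\<^bsub>C\<^esub> v \<longrightarrow>
        (\<exists>!w. w \<in> hom C (Dom C u) (Dom C p) \<and> p \<cdot>\<^bsub>C\<^esub> w = u \<and> q \<cdot>\<^bsub>C\<^esub> w = v))"

record ('o, 'm, 'p, 'n) cfunctor =
  OMap :: "'o \<Rightarrow> 'p"
  AMap :: "'m \<Rightarrow> 'n"

definition is_functor ::
  "('o, 'm) category \<Rightarrow> ('p, 'n) category \<Rightarrow> ('o, 'm, 'p, 'n) cfunctor \<Rightarrow> bool" where
  "is_functor C D F \<longleftrightarrow>
     is_category C \<and> is_category D \<and>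
     (\<forall>a\<in>Obj C. OMap F a \<in> Obj D) \<and>
     (\<forall>f\<in>Arr C. AMap F f \<in> hom D (OMap F (Dom C f)) (OMap F (Cod C f))) \<and>
     (\<forall>a\<in>Obj C. AMap F (Id C a) = Id D (OMap F a)) \<and>
     (\<forall>f\<in>Arr C. \<forall>g\<in>Arr C. Cod C f = Dom C g \<longrightarrow>
        AMap F (g \<cdot>\<^bsub>C\<^esub> f) = AMap F g \<cdot>\<^bsub>D\<^esub> AMap F f)"

definition id_functor :: "('o, 'm, 'o, 'm) cfunctor" where
  "id_functor = \<lparr>OMap = (\<lambda>a. a), AMap = (\<lambda>f. f)\<rparr>"

definition comp_functor ::
  "('p, 'n, 'q, 'k) cfunctor \<Rightarrow> ('o, 'm, 'p, 'n) cfunctor \<Rightarrow> ('o, 'm, 'q, 'k) cfunctor" where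
  "comp_functor G F = \<lparr>OMap = (\<lambda>a. OMap G (OMap F a)), AMap = (\<lambda>f. AMap G (AMap F f))\<rparr>"

definition is_nat_trans ::
  "('o, 'm) category \<Rightarrow> ('p, 'n) category \<Rightarrow> ('o, 'm, 'p, 'n) cfunctor \<Rightarrow>
   ('o, 'm, 'p, 'n) cfunctor \<Rightarrow> ('o \<Rightarrow> 'n) \<Rightarrow> bool" where
  "is_nat_trans C D F G \<alpha> \<longleftrightarrow>
     is_functor C D F \<and> is_functor C D G \<and>
     (\<forall>a\<in>Obj C. \<alpha> a \<in> hom D (OMap F a) (OMap G a)) \<and>
     (\<forall>f\<in>Arr C. \<alpha> (Cod C f) \<cdot>\<^bsub>D\<^esub> AMap F f = AMap G f \<cdot>\<^bsub>D\<^esub> \<alpha> (Dom C f))"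

text \<open>\<open>G\<close> is right adjoint to \<open>F\<close> with counit \<open>\<epsilon>\<close>: the maps
  \<open>Hom(a, G b) \<rightarrow> Hom(F a, b)\<close>, \<open>g \<mapsto> \<epsilon>\<^sub>b \<circ> F g\<close>, are bijections (natural in \<open>a\<close> by
  functoriality of \<open>F\<close>, and in \<open>b\<close> by naturality of \<open>\<epsilon>\<close>).\<close>

definition is_right_adjoint ::
  "('o, 'm) category \<Rightarrow> ('p, 'n) category \<Rightarrow> ('o, 'm, 'p, 'n) cfunctor \<Rightarrow>
   ('p, 'n, 'o, 'm) cfunctor \<Rightarrow> ('p \<Rightarrow> 'n) \<Rightarrow> bool" where
  "is_right_adjoint C D F G \<epsilon> \<longleftrightarrow>
     is_functor C D F \<and> is_functor D C G \<and>
     is_nat_trans D D (comp_functor F G) id_functor \<epsilon> \<and>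
     (\<forall>a\<in>Obj C. \<forall>b\<in>Obj D.
        bij_betw (\<lambda>g. \<epsilon> b \<cdot>\<^bsub>D\<^esub> AMap F g) (hom C a (OMap G b)) (hom D (OMap F a) b))"

definition adjunct ::
  "('o, 'm) category \<Rightarrow> ('p, 'n) category \<Rightarrow> ('o, 'm, 'p, 'n) cfunctor \<Rightarrow>
   ('p, 'n, 'o, 'm) cfunctor \<Rightarrow> ('p \<Rightarrow> 'n) \<Rightarrow> 'o \<Rightarrow> 'p \<Rightarrow> 'n \<Rightarrow> 'm" where
  "adjunct C D F G \<epsilon> a b f = (THE g. g \<in> hom C a (OMap G b) \<and> \<epsilon> b \<cdot>\<^bsub>D\<^esub> AMap F g = f)"

definition is_monad ::
  "('o, 'm) category \<Rightarrow> ('o, 'm, 'o, 'm) cfunctor \<Rightarrow> ('o \<Rightarrow> 'm) \<Rightarrow> ('o \<Rightarrow> 'm) \<Rightarrow> bool" where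
  "is_monad C S \<eta> \<nu> \<longleftrightarrow>
     is_functor C C S \<and>
     is_nat_trans C C id_functor S \<eta> \<and>
     is_nat_trans C C (comp_functor S S) S \<nu> \<and>
     (\<forall>a\<in>Obj C. \<nu> a \<cdot>\<^bsub>C\<^esub> AMap S (\<nu> a) = \<nu> a \<cdot>\<^bsub>C\<^esub> \<nu> (OMap S a)) \<and>
     (\<forall>a\<in>Obj C. \<nu> a \<cdot>\<^bsub>C\<^esub> AMap S (\<eta> a) = Id C (OMap S a)) \<and>
     (\<forall>a\<in>Obj C. \<nu> a \<cdot>\<^bsub>C\<^esub> \<eta> (OMap S a) = Id C (OMap S a))"

text \<open>The slice category \<open>C/X\<close>: an object is an arrow \<open>\<phi>\<close> with codomain \<open>X\<close>, and a
  morphism \<open>\<phi> \<rightarrow> \<psi>\<close> is a triple \<open>(\<phi>, f, \<psi>)\<close> with \<open>\<psi> \<circ> f = \<phi>\<close>.\<close>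

definition slice :: "('o, 'm) category \<Rightarrow> 'o \<Rightarrow> ('m, 'm \<times> 'm \<times> 'm) category" where
  "slice C X =
     \<lparr>Obj = {\<phi> \<in> Arr C. Cod C \<phi> = X},
      Arr = {(\<phi>, f, \<psi>). \<phi> \<in> Arr C \<and> Cod C \<phi> = X \<and> \<psi> \<in> Arr C \<and> Cod C \<psi> = X \<and>
                        f \<in> hom C (Dom C \<phi>) (Dom C \<psi>) \<and> \<psi> \<cdot>\<^bsub>C\<^esub> f = \<phi>},
      Dom = (\<lambda>(\<phi>, f, \<psi>). \<phi>),
      Cod = (\<lambda>(\<phi>, f, \<psi>). \<psi>),
      Id = (\<lambda>\<phi>. (\<phi>, Id C (Dom C \<phi>), \<phi>)),
      Comp = (\<lambda>(\<phi>', g, \<psi>') (\<phi>, f, \<psi>). (\<phi>, g \<cdot>\<^bsub>C\<^esub> f, \<psi>'))\<rparr>"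

definition forget :: "('o, 'm) category \<Rightarrow> ('m, 'm \<times> 'm \<times> 'm, 'o, 'm) cfunctor" where
  "forget C = \<lparr>OMap = Dom C, AMap = (\<lambda>(\<phi>, f, \<psi>). f)\<rparr>"


section \<open>Operator categories\<close>

text \<open>\<open>is_fiber C one f i p\<close>: the arrow \<open>p\<close> exhibits its domain as the fiber of \<open>f\<close> over the
  point \<open>i : one \<rightarrow> Cod f\<close>.\<close>

definition is_fiber :: "('o, 'm) category \<Rightarrow> 'o \<Rightarrow> 'm \<Rightarrow> 'm \<Rightarrow> 'm \<Rightarrow> bool" where
  "is_fiber C one f i p \<longleftrightarrow>
     i \<in> hom C one (Cod C f) \<and> (\<exists>q \<in> hom C (Dom C p) one. is_pullback C q p i f)"

text \<open>Essential smallness needs no clause: objects and arrows form sets of elements of HOL types,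
  so every category in the present sense is small.\<close>

definition operator_category :: "('o, 'm) category \<Rightarrow> 'o \<Rightarrow> bool" where
  "operator_category C one \<longleftrightarrow>
     is_category C \<and> is_terminal C one \<and>
     (\<forall>a\<in>Obj C. \<forall>b\<in>Obj C. finite (hom C a b)) \<and>
     (\<forall>f\<in>Arr C. \<forall>i\<in>hom C one (Cod C f). \<exists>p. is_fiber C one f i p)"

text \<open>The category of pairs \<open>(I, i)\<close> with \<open>i\<close> a point of \<open>I\<close>, whose morphisms
  \<open>(I, i) \<rightarrow> (J, j)\<close> are the \<open>f : I \<rightarrow> J\<close> with \<open>f \<circ> i = j\<close> having \<open>{i}\<close> as their fiber over
  \<open>j\<close>.\<close>

definition pointed ::
  "('o, 'm) category \<Rightarrow> 'o \<Rightarrow> ('o \<times> 'm, ('o \<times> 'm) \<times> 'm \<times> ('o \<times> 'm)) category" where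
  "pointed C one =
     \<lparr>Obj = {(I, i). I \<in> Obj C \<and> i \<in> hom C one I},
      Arr = {((I, i), f, (J, j)).
               I \<in> Obj C \<and> i \<in> hom C one I \<and> J \<in> Obj C \<and> j \<in> hom C one J \<and>
               f \<in> hom C I J \<and> f \<cdot>\<^bsub>C\<^esub> i = j \<and> is_fiber C one f j i},
      Dom = (\<lambda>(x, f, y). x),
      Cod = (\<lambda>(x, f, y). y),
      Id = (\<lambda>x. (x, Id C (fst x), x)),
      Comp = (\<lambda>(x', g, y') (x, f, y). (x, g \<cdot>\<^bsub>C\<^esub> f, y'))\<rparr>"

definition point_classifier :: "('o, 'm) category \<Rightarrow> 'o \<Rightarrow> 'o \<Rightarrow> 'm \<Rightarrow> bool" where
  "point_classifier C one T t \<longleftrightarrow> is_terminal (pointed C one) (T, t)"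

text \<open>The classifying morphism \<open>\<chi>\<^sub>i\<close> of the point \<open>i\<close> of \<open>I = Cod C i\<close>.\<close>

definition classifying :: "('o, 'm) category \<Rightarrow> 'o \<Rightarrow> 'o \<Rightarrow> 'm \<Rightarrow> 'm \<Rightarrow> 'm" where
  "classifying C one T t i =
     (THE f. ((Cod C i, i), f, (T, t)) \<in> hom (pointed C one) (Cod C i, i) (T, t))"

text \<open>The special fiber functor depends on a choice, for each \<open>\<phi> : J \<rightarrow> T\<close>, of a fiber
  \<open>pr \<phi> : J\<^sub>t \<rightarrow> J\<close>.\<close>

definition fiber_choice :: "('o, 'm) category \<Rightarrow> 'o \<Rightarrow> 'o \<Rightarrow> 'm \<Rightarrow> ('m \<Rightarrow> 'm) \<Rightarrow> bool" where
  "fiber_choice C one T t pr \<longleftrightarrow> (\<forall>\<phi> \<in> Obj (slice C T). is_fiber C one \<phi> t (pr \<phi>))"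

definition fib :: "('o, 'm) category \<Rightarrow> ('m \<Rightarrow> 'm) \<Rightarrow> ('m, 'm \<times> 'm \<times> 'm, 'o, 'm) cfunctor" where
  "fib C pr =
     \<lparr>OMap = (\<lambda>\<phi>. Dom C (pr \<phi>)),
      AMap = (\<lambda>(\<phi>, f, \<psi>). THE g. g \<in> hom C (Dom C (pr \<phi>)) (Dom C (pr \<psi>)) \<and>
                                   pr \<psi> \<cdot>\<^bsub>C\<^esub> g = f \<cdot>\<^bsub>C\<^esub> pr \<phi>)\<rparr>"

definition perfect :: "('o, 'm) category \<Rightarrow> 'o \<Rightarrow> bool" where
  "perfect C one \<longleftrightarrow>
     (\<exists>T t. point_classifier C one T t \<and>
        (\<exists>pr. fiber_choice C one T t pr \<and>
           (\<exists>E \<kappa>. is_right_adjoint (slice C T) C (fib C pr) E \<kappa>)))"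


section \<open>The endofunctor, its unit and its multiplication\<close>

text \<open>Throughout, \<open>(T, t)\<close> is a point classifier, \<open>pr\<close> a choice of fibers over \<open>t\<close>, and \<open>E\<close> a
  right adjoint of \<open>fib C pr\<close> with counit \<open>\<kappa>\<close>; thus \<open>e\<^sub>I = OMap E I\<close> and
  \<open>\<kappa> I : (TI)\<^sub>t \<rightarrow> I\<close>.\<close>

definition T_functor ::
  "('o, 'm) category \<Rightarrow> ('o, 'm, 'm, 'm \<times> 'm \<times> 'm) cfunctor \<Rightarrow> ('o, 'm, 'o, 'm) cfunctor" where
  "T_functor C E = comp_functor (forget C) E"

definition T_unit ::
  "('o, 'm) category \<Rightarrow> ('m \<Rightarrow> 'm) \<Rightarrow> ('o, 'm, 'm, 'm \<times> 'm \<times> 'm) cfunctor \<Rightarrow> ('o \<Rightarrow> 'm) \<Rightarrow>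
   'o \<Rightarrow> 'm" where
  "T_unit C pr E \<kappa> I = pr (OMap E I) \<cdot>\<^bsub>C\<^esub> arr_inverse C (\<kappa> I)"

text \<open>The object \<open>\<chi>\<^sub>t \<circ> T(\<phi>) : TJ \<rightarrow> T\<close> of the slice over \<open>T\<close>, for \<open>\<phi> : J \<rightarrow> T\<close>, where
  \<open>t\<close> is viewed as the point \<open>\<iota>\<^sub>T \<circ> t\<close> of \<open>TT\<close>.\<close>

definition T_chi ::
  "('o, 'm) category \<Rightarrow> 'o \<Rightarrow> 'o \<Rightarrow> 'm \<Rightarrow> ('m \<Rightarrow> 'm) \<Rightarrow>
   ('o, 'm, 'm, 'm \<times> 'm \<times> 'm) cfunctor \<Rightarrow> ('o \<Rightarrow> 'm) \<Rightarrow> 'm \<Rightarrow> 'm" where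
  "T_chi C one T t pr E \<kappa> \<phi> =
     classifying C one T t (T_unit C pr E \<kappa> T \<cdot>\<^bsub>C\<^esub> t) \<cdot>\<^bsub>C\<^esub> AMap (T_functor C E) \<phi>"

text \<open>The identification of the chosen fiber of \<open>\<chi>\<^sub>t \<circ> T(\<phi>)\<close> over \<open>t\<close> with \<open>J\<^sub>t\<close> via
  \<open>\<iota>\<^sub>J : J \<rightarrow> TJ\<close>, i.e. compatibly with the two inclusions into \<open>TJ\<close>.\<close>

definition T_ident ::
  "('o, 'm) category \<Rightarrow> 'o \<Rightarrow> 'o \<Rightarrow> 'm \<Rightarrow> ('m \<Rightarrow> 'm) \<Rightarrow>
   ('o, 'm, 'm, 'm \<times> 'm \<times> 'm) cfunctor \<Rightarrow> ('o \<Rightarrow> 'm) \<Rightarrow> 'm \<Rightarrow> 'm" where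
  "T_ident C one T t pr E \<kappa> \<phi> =
     (THE \<theta>. \<theta> \<in> hom C (Dom C (pr (T_chi C one T t pr E \<kappa> \<phi>))) (Dom C (pr \<phi>)) \<and>
             T_unit C pr E \<kappa> (Dom C \<phi>) \<cdot>\<^bsub>C\<^esub> pr \<phi> \<cdot>\<^bsub>C\<^esub> \<theta> = pr (T_chi C one T t pr E \<kappa> \<phi>))"

text \<open>\<open>\<sigma>\<^sub>J : TJ \<rightarrow> T(J\<^sub>t)\<close> for \<open>\<phi> : J \<rightarrow> T\<close>.\<close>

definition T_sigma ::
  "('o, 'm) category \<Rightarrow> 'o \<Rightarrow> 'o \<Rightarrow> 'm \<Rightarrow> ('m \<Rightarrow> 'm) \<Rightarrow>
   ('o, 'm, 'm, 'm \<times> 'm \<times> 'm) cfunctor \<Rightarrow> ('o \<Rightarrow> 'm) \<Rightarrow> 'm \<Rightarrow> 'm" where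
  "T_sigma C one T t pr E \<kappa> \<phi> =
     AMap (forget C)
       (adjunct (slice C T) C (fib C pr) E \<kappa> (T_chi C one T t pr E \<kappa> \<phi>) (OMap (fib C pr) \<phi>)
          (T_ident C one T t pr E \<kappa> \<phi>))"

definition T_mult ::
  "('o, 'm) category \<Rightarrow> 'o \<Rightarrow> 'o \<Rightarrow> 'm \<Rightarrow> ('m \<Rightarrow> 'm) \<Rightarrow>
   ('o, 'm, 'm, 'm \<times> 'm \<times> 'm) cfunctor \<Rightarrow> ('o \<Rightarrow> 'm) \<Rightarrow> 'o \<Rightarrow> 'm" where
  "T_mult C one T t pr E \<kappa> I =
     AMap (T_functor C E) (\<kappa> I) \<cdot>\<^bsub>C\<^esub> T_sigma C one T t pr E \<kappa> (OMap E I)"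

end

(* A morphism J -> TI amounts to a morphism phi : J -> T together with a morphism from the fiber of
   phi over t to I. Hence a morphism g : J -> TI is determined by the composite e_I g and by the
   restriction of g to the fiber of e_I g over t. Both sides of each monad law agree on the relevant
   fiber by construction of iota and mu, and their composites with e_I are compared by reducing to
   morphisms into T that classify the same point:
   chi_t iota_T = id, chi_t T(t) = e_1 and chi_t mu_T = chi_t T(chi_t). *)

theory Submission
  imports Defs
begin

section \<open>Fibers over points\<close>

text \<open>\<open>T\<close> behaves like the partial map classifier of a topos, with fibers over
  points as the admissible domains. The obstacle is that fib, kappa, sigma and mu all depend on
  chosen fibers and on transposes given by definite descriptions. The monad laws are therefore
  derived from facts free of these choices: \<open>\<iota> I\<close> is itself a fiber of
  \<open>e I\<close> over \<open>t\<close>, and mu_I satisfies e_I mu_I = chi_t T(e_I) and mu_I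
  iota_TI iota_I = iota_I, two equations that determine it. The adjunction serves only to supply
  these facts, for which kappa must be shown to be invertible. The three equations between morphisms
  into T rest on one pasting property, \<open>is_fiber_paste\<close>: it computes the fiber of chi_t
  h from the fiber of e_T h.\<close>

locale cat =
  fixes C :: "('o, 'm) category" (structure)
  assumes is_category: "is_category C"
begin

lemma in_hom_iff [simp]: "f \<in> hom C a b \<longleftrightarrow> f \<in> Arr C \<and> Dom C f = a \<and> Cod C f = b"
  by (simp add: hom_def)

lemma Dom_Cod_Obj [simp]:
  assumes "f \<in> Arr C"
  shows "Dom C f \<in> Obj C" "Cod C f \<in> Obj C"
  using is_category assms by (auto simp: is_category_def)

lemma Id_simps [simp]:
  assumes "a \<in> Obj C"
  shows "Id C a \<in> Arr C" "Dom C (Id C a) = a" "Cod C (Id C a) = a"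
  using is_category assms by (auto simp: is_category_def)

lemma comp_simps [simp]:
  assumes "f \<in> Arr C" "g \<in> Arr C" "Cod C f = Dom C g"
  shows "g \<cdot> f \<in> Arr C" "Dom C (g \<cdot> f) = Dom C f" "Cod C (g \<cdot> f) = Cod C g"
  using is_category assms by (auto simp: is_category_def)

lemma comp_Id [simp]:
  "f \<in> Arr C \<Longrightarrow> Dom C f = a \<Longrightarrow> f \<cdot> Id C a = f"
  "f \<in> Arr C \<Longrightarrow> Cod C f = a \<Longrightarrow> Id C a \<cdot> f = f"
  using is_category by (auto simp: is_category_def)

lemma comp_assoc [simp]:
  assumes "f \<in> Arr C" "g \<in> Arr C" "h \<in> Arr C" "Cod C f = Dom C g" "Cod C g = Dom C h"
  shows "(h \<cdot> g) \<cdot> f = h \<cdot> g \<cdot> f"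
  using is_category assms by (auto simp: is_category_def)

text \<open>Composites are normalised to right-nested form, where an equation for
  \<open>g \<cdot> f\<close> no longer matches if a further factor \<open>u\<close> follows; this
  restores its use there.\<close>

lemma comp_reassoc:
  assumes "g \<cdot> f = k" "f \<in> Arr C" "g \<in> Arr C" "u \<in> Arr C" "Cod C f = Dom C g" "Cod C u = Dom C f"
  shows "g \<cdot> f \<cdot> u = k \<cdot> u"
  using assms comp_assoc by metis

lemma arr_inverse_eq:
  assumes "f \<in> Arr C" "g \<in> Arr C" "Cod C g = Dom C f" "Cod C f = Dom C g"
    "g \<cdot> f = Id C (Dom C f)" "f \<cdot> g = Id C (Cod C f)"
  shows "arr_inverse C f = g"
  unfolding arr_inverse_def
proof (rule the_equality)
  show "g \<in> hom C (Cod C f) (Dom C f) \<and> g \<cdot> f = Id C (Dom C f) \<and> f \<cdot> g = Id C (Cod C f)"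
    using assms by simp
  fix h assume h: "h \<in> hom C (Cod C f) (Dom C f) \<and> h \<cdot> f = Id C (Dom C f) \<and> f \<cdot> h = Id C (Cod C f)"
  then have "h = h \<cdot> f \<cdot> g"
    using assms by simp
  also have "\<dots> = (h \<cdot> f) \<cdot> g"
    using h assms by (subst comp_assoc) auto
  also have "\<dots> = g"
    using h assms by simp
  finally show "h = g" .
qed

lemma slice_simps [simp]:
  "\<phi> \<in> Obj (slice C X) \<longleftrightarrow> \<phi> \<in> Arr C \<and> Cod C \<phi> = X"
  "(\<phi>, f, \<psi>) \<in> hom (slice C X) \<phi>' \<psi>' \<longleftrightarrow> \<phi>' = \<phi> \<and> \<psi>' = \<psi> \<and> \<phi> \<in> Arr C \<and> Cod C \<phi> = X \<and>
     \<psi> \<in> Arr C \<and> Cod C \<psi> = X \<and> f \<in> hom C (Dom C \<phi>) (Dom C \<psi>) \<and> \<psi> \<cdot> f = \<phi>"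
  by (auto simp: slice_def hom_def)

lemma slice_homE:
  assumes "g \<in> hom (slice C X) \<phi> \<psi>"
  obtains f where "g = (\<phi>, f, \<psi>)" "f \<in> Arr C" "Dom C f = Dom C \<phi>" "Cod C f = Dom C \<psi>" "\<psi> \<cdot> f = \<phi>"
  using assms by (cases g) (auto simp: slice_def hom_def)

end

section \<open>Terminal object, fibers over points, and pasting of fibers\<close>

locale terminal_cat = cat C for C :: "('o, 'm) category" (structure) +
  fixes one :: 'o
  assumes terminal: "is_terminal C one"
begin

definition bang :: "'o \<Rightarrow> 'm" where
  "bang a = (THE f. f \<in> hom C a one)"

lemma one_Obj [simp]: "one \<in> Obj C"
  using terminal by (simp add: is_terminal_def)

lemma
  assumes "a \<in> Obj C"
  shows bang_simps [simp]: "bang a \<in> Arr C" "Dom C (bang a) = a" "Cod C (bang a) = one"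
    and bang_unique: "f \<in> hom C a one \<Longrightarrow> f = bang a"
proof -
  have ex1: "\<exists>!f. f \<in> hom C a one"
    using terminal assms unfolding is_terminal_def by blast
  have "bang a \<in> hom C a one"
    unfolding bang_def by (rule theI') (rule ex1)
  with ex1 show "bang a \<in> Arr C" "Dom C (bang a) = a" "Cod C (bang a) = one"
    "f \<in> hom C a one \<Longrightarrow> f = bang a"
    by (simp, simp, simp, blast)
qed

lemma bang_comp [simp]:
  assumes "f \<in> Arr C" "Cod C f = a"
  shows "bang a \<cdot> f = bang (Dom C f)"
  using assms by (intro bang_unique) auto

lemma bang_one [simp]: "bang one = Id C one"
  using bang_unique[of one "Id C one"] by simp

lemma is_fiber_arr:
  assumes "is_fiber C one f i p"
  shows "f \<in> Arr C" "i \<in> Arr C" "Dom C i = one" "Cod C i = Cod C f" "p \<in> Arr C" "Cod C p = Dom C f"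
proof -
  obtain q where q: "q \<in> hom C (Dom C p) one" and i: "i \<in> hom C one (Cod C f)"
    and pb: "is_pullback C q p i f"
    using assms unfolding is_fiber_def by blast
  from pb have "f \<in> Arr C" "p \<in> Arr C" "Cod C p = Dom C f"
    unfolding is_pullback_def by blast+
  with i show "f \<in> Arr C" "i \<in> Arr C" "Dom C i = one" "Cod C i = Cod C f" "p \<in> Arr C" "Cod C p = Dom C f"
    by simp_all
qed

lemma fiber_comm:
  assumes "is_fiber C one f i p"
  shows "f \<cdot> p = i \<cdot> bang (Dom C p)"
proof -
  obtain q where q: "q \<in> hom C (Dom C p) one" and "is_pullback C q p i f"
    using assms unfolding is_fiber_def by blast
  then have "f \<cdot> p = i \<cdot> q"
    unfolding is_pullback_def by simp
  moreover have "q = bang (Dom C p)"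
    using q is_fiber_arr[OF assms] by (intro bang_unique) auto
  ultimately show ?thesis
    by simp
qed

text \<open>The leg of the square into \<open>one\<close> is forced to be \<open>bang\<close> and
  carries no information. What remains of the pullback is that \<open>p\<close> is monic and that
  exactly the arrows sent by \<open>f\<close> to the constant \<open>i\<close> factor through
  it.\<close>

lemma
  assumes "is_fiber C one f i p"
  shows fiber_lift: "u \<in> Arr C \<Longrightarrow> Cod C u = Dom C f \<Longrightarrow> f \<cdot> u = i \<cdot> bang (Dom C u) \<Longrightarrow>
        \<exists>w. w \<in> Arr C \<and> Dom C w = Dom C u \<and> Cod C w = Dom C p \<and> p \<cdot> w = u"
    and fiber_mono: "w \<in> Arr C \<Longrightarrow> w' \<in> Arr C \<Longrightarrow> Dom C w = Dom C w' \<Longrightarrow> Cod C w = Dom C p \<Longrightarrow>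
        Cod C w' = Dom C p \<Longrightarrow> p \<cdot> w = p \<cdot> w' \<Longrightarrow> w = w'"
proof -
  note arr = is_fiber_arr[OF assms] and comm = fiber_comm[OF assms]
  obtain q where q: "q \<in> hom C (Dom C p) one" and pb: "is_pullback C q p i f"
    using assms unfolding is_fiber_def by blast
  have q_def: "q = bang (Dom C p)"
    using q arr by (intro bang_unique) auto
  have ex1: "\<exists>!w. w \<in> hom C (Dom C u) (Dom C p) \<and> p \<cdot> w = u"
    if u: "u \<in> Arr C" "Cod C u = Dom C f" "f \<cdot> u = i \<cdot> bang (Dom C u)" for u
  proof -
    have "\<exists>!w. w \<in> hom C (Dom C x) (Dom C q) \<and> q \<cdot> w = x \<and> p \<cdot> w = u"
      if "x \<in> Arr C" "Dom C x = Dom C u" "Cod C x = Dom C i" "i \<cdot> x = f \<cdot> u" for x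
      using pb u that unfolding is_pullback_def by blast
    from this[of "bang (Dom C u)"]
    have *: "\<exists>!w. w \<in> hom C (Dom C u) (Dom C p) \<and> bang (Dom C p) \<cdot> w = bang (Dom C u) \<and> p \<cdot> w = u"
      using u arr by (simp add: q_def)
    have "bang (Dom C p) \<cdot> w = bang (Dom C u)" if "w \<in> hom C (Dom C u) (Dom C p)" for w
      using that arr by simp
    with * show ?thesis
      by blast
  qed
  show "\<exists>w. w \<in> Arr C \<and> Dom C w = Dom C u \<and> Cod C w = Dom C p \<and> p \<cdot> w = u"
    if "u \<in> Arr C" "Cod C u = Dom C f" "f \<cdot> u = i \<cdot> bang (Dom C u)"
    using ex1_implies_ex[OF ex1[OF that]] by simp
  show "w = w'"
    if w: "w \<in> Arr C" "w' \<in> Arr C" "Dom C w = Dom C w'" "Cod C w = Dom C p"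
        "Cod C w' = Dom C p" "p \<cdot> w = p \<cdot> w'"
  proof -
    have "f \<cdot> p \<cdot> w = (i \<cdot> bang (Dom C p)) \<cdot> w"
      using w arr by (intro comp_reassoc[OF comm]) auto
    then have "f \<cdot> p \<cdot> w = i \<cdot> bang (Dom C (p \<cdot> w))"
      using w(1,4) arr by simp
    then have "\<exists>!v. v \<in> hom C (Dom C (p \<cdot> w)) (Dom C p) \<and> p \<cdot> v = p \<cdot> w"
      using w(1,4) arr by (intro ex1) simp_all
    moreover have "w \<in> hom C (Dom C (p \<cdot> w)) (Dom C p) \<and> p \<cdot> w = p \<cdot> w"
      using w(1,4) arr by simp
    moreover have "w' \<in> hom C (Dom C (p \<cdot> w)) (Dom C p) \<and> p \<cdot> w' = p \<cdot> w"
      using w arr by simp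
    ultimately show ?thesis
      unfolding ex1_iff_ex_Uniq by (blast dest: Uniq_D)
  qed
qed

lemma is_fiberI:
  assumes arr: "f \<in> Arr C" "i \<in> Arr C" "Dom C i = one" "Cod C i = Cod C f" "p \<in> Arr C" "Cod C p = Dom C f"
    and comm: "f \<cdot> p = i \<cdot> bang (Dom C p)"
    and mono: "\<And>w w'. w \<in> Arr C \<Longrightarrow> w' \<in> Arr C \<Longrightarrow> Dom C w = Dom C w' \<Longrightarrow> Cod C w = Dom C p \<Longrightarrow>
        Cod C w' = Dom C p \<Longrightarrow> p \<cdot> w = p \<cdot> w' \<Longrightarrow> w = w'"
    and lift: "\<And>u. u \<in> Arr C \<Longrightarrow> Cod C u = Dom C f \<Longrightarrow> f \<cdot> u = i \<cdot> bang (Dom C u) \<Longrightarrow>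
        \<exists>w. w \<in> Arr C \<and> Dom C w = Dom C u \<and> Cod C w = Dom C p \<and> p \<cdot> w = u"
  shows "is_fiber C one f i p"
proof -
  have "is_pullback C (bang (Dom C p)) p i f"
    unfolding is_pullback_def
  proof (intro conjI ballI impI)
    fix u v
    assume "u \<in> Arr C" "v \<in> Arr C" and
      uv: "Dom C u = Dom C v \<and> Cod C u = Dom C i \<and> Cod C v = Dom C f \<and> i \<cdot> u = f \<cdot> v"
    then have u: "u = bang (Dom C v)"
      using arr by (intro bang_unique) auto
    then obtain w where w: "w \<in> Arr C" "Dom C w = Dom C v" "Cod C w = Dom C p" "p \<cdot> w = v"
      using lift[of v] uv \<open>v \<in> Arr C\<close> by auto
    show "\<exists>!w. w \<in> hom C (Dom C u) (Dom C (bang (Dom C p))) \<and> bang (Dom C p) \<cdot> w = u \<and> p \<cdot> w = v"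
    proof (rule ex1I[of _ w])
      show "w \<in> hom C (Dom C u) (Dom C (bang (Dom C p))) \<and> bang (Dom C p) \<cdot> w = u \<and> p \<cdot> w = v"
        unfolding u using w \<open>v \<in> Arr C\<close> arr(5) by simp
      fix w' assume "w' \<in> hom C (Dom C u) (Dom C (bang (Dom C p))) \<and> bang (Dom C p) \<cdot> w' = u \<and> p \<cdot> w' = v"
      then have w': "w' \<in> Arr C" "Dom C w' = Dom C v" "Cod C w' = Dom C p" "p \<cdot> w' = v"
        using uv arr(5) by simp_all
      show "w' = w"
        by (rule mono) (simp_all only: w w')
    qed
  qed (use arr comm in simp_all)
  moreover have "bang (Dom C p) \<in> hom C (Dom C p) one" "i \<in> hom C one (Cod C f)"
    using arr by auto
  ultimately show ?thesis
    unfolding is_fiber_def by blast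
qed

lemma point_mono:
  assumes "w \<in> Arr C" "w' \<in> Arr C" "Dom C w = Dom C w'" "Cod C w = one" "Cod C w' = one"
  shows "w = w'"
  using bang_unique[of "Dom C w" w] bang_unique[of "Dom C w" w'] assms by auto

text \<open>For \<open>i = t\<close> this makes the identity of T the classifying morphism of
  \<open>t\<close>.\<close>

lemma is_fiber_Id:
  assumes "i \<in> Arr C" "Dom C i = one" "Cod C i = a"
  shows "is_fiber C one (Id C a) i i"
proof (rule is_fiberI)
  fix w w' assume "w \<in> Arr C" "w' \<in> Arr C" "Dom C w = Dom C w'" "Cod C w = Dom C i" "Cod C w' = Dom C i"
  then show "w = w'" unfolding assms(2) by (rule point_mono)
next
  fix u assume "u \<in> Arr C" "Cod C u = Dom C (Id C a)" "Id C a \<cdot> u = i \<cdot> bang (Dom C u)"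
  then show "\<exists>w. w \<in> Arr C \<and> Dom C w = Dom C u \<and> Cod C w = Dom C i \<and> i \<cdot> w = u"
    using assms by (intro exI[of _ "bang (Dom C u)"]) auto
qed (use assms in auto)

text \<open>A constant morphism at \<open>i\<close> has its whole source as fiber. It applies to
  \<open>e T \<cdot> \<iota> T\<close> and to \<open>t\<close> itself.\<close>

lemma is_fiber_bang:
  assumes "i \<in> Arr C" "Dom C i = one" "a \<in> Obj C"
  shows "is_fiber C one (i \<cdot> bang a) i (Id C a)"
  using assms by (intro is_fiberI) auto

lemma is_fiber_iso:
  assumes fib: "is_fiber C one f i p"
    and arr: "k \<in> Arr C" "l \<in> Arr C" "Cod C k = Dom C p" "Dom C l = Dom C p" "Cod C l = Dom C k"
    and inv: "k \<cdot> l = Id C (Dom C p)" "l \<cdot> k = Id C (Dom C k)"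
  shows "is_fiber C one f i (p \<cdot> k)"
proof (rule is_fiberI)
  note fib_arr = is_fiber_arr[OF fib] and comm = fiber_comm[OF fib]
  show "f \<cdot> p \<cdot> k = i \<cdot> bang (Dom C (p \<cdot> k))"
    using fib_arr arr by (subst comp_reassoc[OF comm]) auto
  fix w w' assume w: "w \<in> Arr C" "w' \<in> Arr C" "Dom C w = Dom C w'" "Cod C w = Dom C (p \<cdot> k)"
    "Cod C w' = Dom C (p \<cdot> k)" "(p \<cdot> k) \<cdot> w = (p \<cdot> k) \<cdot> w'"
  have "k \<cdot> w = k \<cdot> w'"
    by (rule fiber_mono[OF fib]) (use w fib_arr arr in simp_all)
  then have "l \<cdot> k \<cdot> w = l \<cdot> k \<cdot> w'" by simp
  moreover have "l \<cdot> k \<cdot> w = w" "l \<cdot> k \<cdot> w' = w'"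
    using w fib_arr arr by (auto simp: comp_reassoc[OF inv(2)])
  ultimately show "w = w'" by simp
next
  note fib_arr = is_fiber_arr[OF fib]
  fix u assume "u \<in> Arr C" "Cod C u = Dom C f" "f \<cdot> u = i \<cdot> bang (Dom C u)"
  then obtain w where w: "w \<in> Arr C" "Dom C w = Dom C u" "Cod C w = Dom C p" "p \<cdot> w = u"
    using fiber_lift[OF fib] by metis
  then have "(p \<cdot> k) \<cdot> l \<cdot> w = u"
    using fib_arr arr by (simp add: comp_reassoc[OF inv(1)])
  then show "\<exists>w. w \<in> Arr C \<and> Dom C w = Dom C u \<and> Cod C w = Dom C (p \<cdot> k) \<and> (p \<cdot> k) \<cdot> w = u"
    using w fib_arr arr by (intro exI[of _ "l \<cdot> w"]) auto
qed (use is_fiber_arr[OF fib] arr in auto)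

lemma fiber_iso_unique:
  assumes p: "is_fiber C one f i p" and q: "is_fiber C one f i q"
  obtains \<theta> \<theta>' where "\<theta> \<in> Arr C" "Dom C \<theta> = Dom C p" "Cod C \<theta> = Dom C q" "q \<cdot> \<theta> = p"
    "\<theta>' \<in> Arr C" "Dom C \<theta>' = Dom C q" "Cod C \<theta>' = Dom C p" "\<theta> \<cdot> \<theta>' = Id C (Dom C q)"
proof -
  note arr = is_fiber_arr[OF p] is_fiber_arr[OF q]
  obtain \<theta> where \<theta>: "\<theta> \<in> Arr C" "Dom C \<theta> = Dom C p" "Cod C \<theta> = Dom C q" "q \<cdot> \<theta> = p"
    using fiber_lift[OF q arr(5,6) fiber_comm[OF p]] by metis
  obtain \<theta>' where \<theta>': "\<theta>' \<in> Arr C" "Dom C \<theta>' = Dom C q" "Cod C \<theta>' = Dom C p" "p \<cdot> \<theta>' = q"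
    using fiber_lift[OF p arr(11,12) fiber_comm[OF q]] by metis
  have "q \<cdot> \<theta> \<cdot> \<theta>' = q"
    using \<theta> \<theta>' arr by (subst comp_reassoc[OF \<theta>(4)]) simp_all
  have "\<theta> \<cdot> \<theta>' = Id C (Dom C q)"
    by (rule fiber_mono[OF q]) (use \<open>q \<cdot> \<theta> \<cdot> \<theta>' = q\<close> \<theta> \<theta>' arr in simp_all)
  with \<theta> \<theta>' show thesis using that by metis
qed

text \<open>In terms of elements: k(h(x)) = i forces h(x) = a(j), since \<open>k\<close> takes the
  value \<open>i\<close> only there. This point lies in the fiber \<open>a\<close> of
  \<open>e\<close>, so x = s(y) for some y, and a(c(y)) = a(j). As \<open>a\<close> is monic, c(y) =
  j, so y lies in the fiber \<open>p\<close> of \<open>c\<close>. It is used with \<open>k\<close>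
  the morphism chi_t, \<open>a\<close> the unit at T and \<open>j = t\<close>.\<close>

lemma is_fiber_paste:
  assumes k: "is_fiber C one k i (a \<cdot> j)" and e: "is_fiber C one e i' a"
    and s: "is_fiber C one (e \<cdot> h) i' s" and p: "is_fiber C one c j p"
    and arr: "j \<in> Arr C" "Cod C j = Dom C a" "h \<in> Arr C" "Cod C h = Cod C a"
      "c \<in> Arr C" "Dom C c = Dom C s" "Cod C c = Dom C a"
    and comm: "h \<cdot> s = a \<cdot> c"
  shows "is_fiber C one (k \<cdot> h) i (s \<cdot> p)"
proof -
  note fib_k = is_fiber_arr[OF k] and fib_e = is_fiber_arr[OF e]
    and fib_s = is_fiber_arr[OF s] and fib_p = is_fiber_arr[OF p]
  have Dom_e: "Dom C e = Cod C a" and Dom_k: "Dom C k = Cod C a"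
    using fib_e(5,6) fib_k(6) arr(1,2) by simp_all
  have Cod_s: "Cod C s = Dom C h" and Cod_p: "Cod C p = Dom C s"
    using fib_e(1) fib_s(6) fib_p(6) Dom_e arr(3,4,6) by simp_all
  note all_arr = arr Dom_e Dom_k Cod_s Cod_p fib_k(1-4) fib_e(1-3,5) fib_s(5) fib_p(3,5)
  have fib_e_comm: "e \<cdot> a = i' \<cdot> bang (Dom C a)" and fib_p_comm: "c \<cdot> p = j \<cdot> bang (Dom C p)"
    using fiber_comm[OF e] fiber_comm[OF p] .
  have "k \<cdot> a \<cdot> j = i"
    using fiber_comm[OF k] all_arr by simp
  then have fib_k_comm: "k \<cdot> a \<cdot> j \<cdot> w = i \<cdot> w" if "w \<in> Arr C" "Cod C w = one" for w
    using comp_reassoc[of k "a \<cdot> j" i w] that all_arr by simp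
  have comm': "h \<cdot> s \<cdot> w = a \<cdot> c \<cdot> w" if "w \<in> Arr C" "Cod C w = Dom C s" for w
    using comp_reassoc[OF comm, of w] that all_arr by simp
  show ?thesis
  proof (rule is_fiberI)
    show "(k \<cdot> h) \<cdot> s \<cdot> p = i \<cdot> bang (Dom C (s \<cdot> p))"
      using all_arr by (simp add: comm' fib_p_comm fib_k_comm)
    fix w w' assume w: "w \<in> Arr C" "w' \<in> Arr C" "Dom C w = Dom C w'" "Cod C w = Dom C (s \<cdot> p)"
      "Cod C w' = Dom C (s \<cdot> p)" "(s \<cdot> p) \<cdot> w = (s \<cdot> p) \<cdot> w'"
    have "p \<cdot> w = p \<cdot> w'"
      by (rule fiber_mono[OF s]) (use w all_arr in simp_all)
    show "w = w'"
      by (rule fiber_mono[OF p]) (use w all_arr \<open>p \<cdot> w = p \<cdot> w'\<close> in simp_all)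
  next
    fix u assume u: "u \<in> Arr C" "Cod C u = Dom C (k \<cdot> h)" "(k \<cdot> h) \<cdot> u = i \<cdot> bang (Dom C u)"
    then have Cod_u: "Cod C u = Dom C h"
      using all_arr by simp
    obtain w where w: "w \<in> Arr C" "Dom C w = Dom C u" "Cod C w = one" "(a \<cdot> j) \<cdot> w = h \<cdot> u"
      using fiber_lift[OF k, of "h \<cdot> u"] u Cod_u all_arr by auto
    then have hu: "h \<cdot> u = a \<cdot> j \<cdot> w"
      using all_arr by simp
    have "(e \<cdot> h) \<cdot> u = i' \<cdot> bang (Dom C u)"
      using u(1) Cod_u w(1-3) all_arr comp_reassoc[OF fib_e_comm, of "j \<cdot> w"] by (simp add: hu)
    then obtain v where v: "v \<in> Arr C" "Dom C v = Dom C u" "Cod C v = Dom C s" "s \<cdot> v = u"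
      using fiber_lift[OF s, of u] u(1) Cod_u all_arr by auto
    have "a \<cdot> c \<cdot> v = a \<cdot> j \<cdot> w"
      using comm'[OF v(1,3)] hu v(4) by simp
    have "c \<cdot> v = j \<cdot> w"
      by (rule fiber_mono[OF e]) (use \<open>a \<cdot> c \<cdot> v = a \<cdot> j \<cdot> w\<close> v(1-3) w(1-3) all_arr in simp_all)
    moreover have "w = bang (Dom C v)"
      using v(1-3) w(1-3) u(1) by (intro bang_unique) simp_all
    ultimately obtain x where x: "x \<in> Arr C" "Dom C x = Dom C v" "Cod C x = Dom C p" "p \<cdot> x = v"
      using fiber_lift[OF p, of v] v(1-3) all_arr by auto
    then show "\<exists>w. w \<in> Arr C \<and> Dom C w = Dom C u \<and> Cod C w = Dom C (s \<cdot> p) \<and> (s \<cdot> p) \<cdot> w = u"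
      using v all_arr by (intro exI[of _ x]) simp
  qed (use all_arr in simp_all)
qed

end

section \<open>The monad laws from the universal property of \<open>TI\<close>\<close>

text \<open>The object \<open>TI\<close> represents pairs of a morphism \<open>J \<rightarrow> T\<close> and a morphism from its fiber over
  \<open>t\<close> to \<open>I\<close>; \<open>arr_eqI\<close> is the uniqueness half of this universal property. The morphism
  \<open>\<epsilon>\<close> is \<open>\<chi>\<^sub>t : TT \<rightarrow> T\<close>.\<close>

locale partial_map_functor = terminal_cat C one
  for C :: "('o, 'm) category" (structure) and one +
  fixes T :: 'o and t :: 'm and S :: "('o, 'm, 'o, 'm) cfunctor"
    and e :: "'o \<Rightarrow> 'm" and \<iota> :: "'o \<Rightarrow> 'm" and \<epsilon> :: 'm
  assumes S_functor: "is_functor C C S"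
    and \<iota>_nat_trans: "is_nat_trans C C id_functor S \<iota>"
    and t_hom: "t \<in> hom C one T"
    and classified_unique: "is_fiber C one f t i \<Longrightarrow> is_fiber C one g t i \<Longrightarrow> Dom C i = one \<Longrightarrow> f = g"
    and e_hom: "I \<in> Obj C \<Longrightarrow> e I \<in> hom C (OMap S I) T"
    and e_natural: "f \<in> Arr C \<Longrightarrow> e (Cod C f) \<cdot> AMap S f = e (Dom C f)"
    and is_fiber_e: "I \<in> Obj C \<Longrightarrow> is_fiber C one (e I) t (\<iota> I)"
    and is_fiber_\<epsilon>: "is_fiber C one \<epsilon> t (\<iota> T \<cdot> t)"
    and arr_eqI: "I \<in> Obj C \<Longrightarrow> g \<in> hom C J (OMap S I) \<Longrightarrow> h \<in> hom C J (OMap S I) \<Longrightarrow>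
      e I \<cdot> g = e I \<cdot> h \<Longrightarrow> is_fiber C one (e I \<cdot> g) t p \<Longrightarrow> g \<cdot> p = h \<cdot> p \<Longrightarrow> g = h"
begin

lemma S_simps [simp]:
  "a \<in> Obj C \<Longrightarrow> OMap S a \<in> Obj C"
  "f \<in> Arr C \<Longrightarrow> AMap S f \<in> Arr C"
  "f \<in> Arr C \<Longrightarrow> Dom C (AMap S f) = OMap S (Dom C f)"
  "f \<in> Arr C \<Longrightarrow> Cod C (AMap S f) = OMap S (Cod C f)"
  "a \<in> Obj C \<Longrightarrow> AMap S (Id C a) = Id C (OMap S a)"
  "f \<in> Arr C \<Longrightarrow> g \<in> Arr C \<Longrightarrow> Cod C f = Dom C g \<Longrightarrow> AMap S (g \<cdot> f) = AMap S g \<cdot> AMap S f"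
  using S_functor by (simp_all add: is_functor_def)

lemma t_simps [simp]: "t \<in> Arr C" "Dom C t = one" "Cod C t = T" "T \<in> Obj C"
  using t_hom Dom_Cod_Obj(2)[of t] by simp_all

lemma e_simps [simp]:
  assumes "I \<in> Obj C"
  shows "e I \<in> Arr C" "Dom C (e I) = OMap S I" "Cod C (e I) = T"
  using e_hom[OF assms] by simp_all

lemma \<iota>_simps [simp]:
  assumes "I \<in> Obj C"
  shows "\<iota> I \<in> Arr C" "Dom C (\<iota> I) = I" "Cod C (\<iota> I) = OMap S I"
  using \<iota>_nat_trans assms by (simp_all add: is_nat_trans_def id_functor_def)

lemma \<epsilon>_simps [simp]: "\<epsilon> \<in> Arr C" "Dom C \<epsilon> = OMap S T" "Cod C \<epsilon> = T"
  using is_fiber_arr[OF is_fiber_\<epsilon>] by simp_all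

lemma \<iota>_natural [simp]:
  assumes "f \<in> Arr C" "Dom C f = a"
  shows "AMap S f \<cdot> \<iota> a = \<iota> (Cod C f) \<cdot> f"
  using \<iota>_nat_trans assms by (auto simp: is_nat_trans_def id_functor_def)

lemma \<iota>_natural_assoc [simp]:
  assumes "f \<in> Arr C" "Dom C f = a" "u \<in> Arr C" "Cod C u = a"
  shows "AMap S f \<cdot> \<iota> a \<cdot> u = \<iota> (Cod C f) \<cdot> f \<cdot> u"
  using comp_reassoc[OF \<iota>_natural[OF assms(1,2)], of u] assms by auto

lemma e_S [simp]:
  assumes "f \<in> Arr C" "Cod C f = a"
  shows "e a \<cdot> AMap S f = e (Dom C f)"
  using e_natural assms by auto

lemma e_S_assoc [simp]:
  assumes "f \<in> Arr C" "Cod C f = a" "u \<in> Arr C" "Cod C u = OMap S (Dom C f)"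
  shows "e a \<cdot> AMap S f \<cdot> u = e (Dom C f) \<cdot> u"
  using comp_reassoc[OF e_S[OF assms(1,2)], of u] assms by auto

lemma e_\<iota> [simp]:
  assumes "I \<in> Obj C"
  shows "e I \<cdot> \<iota> I = t \<cdot> bang I"
  using fiber_comm[OF is_fiber_e[OF assms]] assms by simp

text \<open>Pasting with h = T(phi): naturality of \<open>e\<close> turns
  \<open>e T \<cdot> AMap S \<phi>\<close> into \<open>e (Dom C \<phi>)\<close>, whose fiber is the
  unit, and by naturality of the unit T(phi) restricts to phi on it. This is the identification of
  fibers that the definition of sigma presupposes.\<close>

lemma is_fiber_\<epsilon>_S:
  assumes "is_fiber C one \<phi> t p"
  shows "is_fiber C one (\<epsilon> \<cdot> AMap S \<phi>) t (\<iota> (Dom C \<phi>) \<cdot> p)"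
proof -
  note arr = is_fiber_arr[OF assms]
  have fib: "is_fiber C one (e T \<cdot> AMap S \<phi>) t (\<iota> (Dom C \<phi>))"
    using is_fiber_e[of "Dom C \<phi>"] arr by simp
  show ?thesis
    by (rule is_fiber_paste[OF is_fiber_\<epsilon> is_fiber_e fib assms]) (use arr in simp_all)
qed

text \<open>Pasting when \<open>h\<close> restricts to the identity of T on its fiber, so that the
  inner fiber is \<open>t\<close> itself.\<close>

lemma is_fiber_\<epsilon>_comp:
  assumes "h \<in> hom C Y (OMap S T)" "is_fiber C one (e T \<cdot> h) t s" "Dom C s = T" "h \<cdot> s = \<iota> T"
  shows "is_fiber C one (\<epsilon> \<cdot> h) t (s \<cdot> t)"
  by (rule is_fiber_paste[OF is_fiber_\<epsilon> is_fiber_e assms(2) is_fiber_Id[of t T]]) (use assms in simp_all)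

text \<open>Both sides classify \<open>t\<close>: since \<open>e T \<cdot> \<iota> T\<close> is
  constant at \<open>t\<close>, the outer fiber is all of T.\<close>

lemma \<epsilon>_\<iota>: "\<epsilon> \<cdot> \<iota> T = Id C T"
proof (rule classified_unique)
  have "is_fiber C one (\<epsilon> \<cdot> \<iota> T) t (Id C T \<cdot> t)"
    by (rule is_fiber_\<epsilon>_comp) (use is_fiber_bang in simp_all)
  then show "is_fiber C one (\<epsilon> \<cdot> \<iota> T) t t" by simp
qed (simp_all add: is_fiber_Id)

text \<open>Both sides classify the point \<open>\<iota> one\<close>, because \<open>t\<close>, read
  as a morphism from \<open>one\<close> to T, has the whole of \<open>one\<close> as its
  fiber.\<close>

lemma \<epsilon>_S_t: "\<epsilon> \<cdot> AMap S t = e one"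
proof (rule classified_unique)
  have "is_fiber C one t t (Id C one)"
    using is_fiber_bang[of t one] by simp
  from is_fiber_\<epsilon>_S[OF this] show "is_fiber C one (\<epsilon> \<cdot> AMap S t) t (\<iota> one)"
    by simp
qed (simp_all add: is_fiber_e)

end

text \<open>By \<open>arr_eqI\<close> the two equations pin down \<open>\<mu> I\<close>: the first
  gives its composite with \<open>e I\<close>, and the second gives its restriction to the fiber of
  that composite, which is \<open>\<iota> (OMap S I) \<cdot> \<iota> I\<close> by
  \<open>is_fiber_\<epsilon>_S\<close>.\<close>

locale partial_map_mult = partial_map_functor C one T t S e \<iota> \<epsilon>
  for C :: "('o, 'm) category" (structure) and one T t S e \<iota> \<epsilon> +
  fixes \<mu> :: "'o \<Rightarrow> 'm"
  assumes \<mu>_hom: "I \<in> Obj C \<Longrightarrow> \<mu> I \<in> hom C (OMap S (OMap S I)) (OMap S I)"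
    and e_\<mu> [simp]: "I \<in> Obj C \<Longrightarrow> e I \<cdot> \<mu> I = \<epsilon> \<cdot> AMap S (e I)"
    and \<mu>_\<iota>_\<iota> [simp]: "I \<in> Obj C \<Longrightarrow> \<mu> I \<cdot> \<iota> (OMap S I) \<cdot> \<iota> I = \<iota> I"
begin

lemma \<mu>_simps [simp]:
  assumes "I \<in> Obj C"
  shows "\<mu> I \<in> Arr C" "Dom C (\<mu> I) = OMap S (OMap S I)" "Cod C (\<mu> I) = OMap S I"
  using \<mu>_hom[OF assms] by simp_all

lemma \<mu>_\<iota>_\<iota>_assoc [simp]:
  assumes "u \<in> Arr C" "Cod C u = I"
  shows "\<mu> I \<cdot> \<iota> (OMap S I) \<cdot> \<iota> I \<cdot> u = \<iota> I \<cdot> u"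
  using comp_reassoc[OF \<mu>_\<iota>_\<iota>, of I u] assms by auto

lemma e_\<mu>_assoc [simp]:
  assumes "I \<in> Obj C" "u \<in> Arr C" "Cod C u = OMap S (OMap S I)"
  shows "e I \<cdot> \<mu> I \<cdot> u = \<epsilon> \<cdot> AMap S (e I) \<cdot> u"
  using comp_reassoc[OF e_\<mu>, of I u] assms by auto

text \<open>Both sides classify \<open>t\<close> pushed into TTT by units. On the left,
  \<open>\<mu> T\<close> plays the role of \<open>h\<close> in
  \<open>is_fiber_\<epsilon>_comp\<close>, as it restricts to \<open>\<iota> T\<close> on its fiber;
  on the right, \<open>\<epsilon>\<close> plays the role of phi in
  \<open>is_fiber_\<epsilon>_S\<close>.\<close>

lemma \<epsilon>_\<mu>: "\<epsilon> \<cdot> \<mu> T = \<epsilon> \<cdot> AMap S \<epsilon>"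
proof (rule classified_unique)
  have "is_fiber C one (e T \<cdot> \<mu> T) t (\<iota> (OMap S T) \<cdot> \<iota> T)"
    using is_fiber_\<epsilon>_S[OF is_fiber_e[of T]] by simp
  then have "is_fiber C one (\<epsilon> \<cdot> \<mu> T) t ((\<iota> (OMap S T) \<cdot> \<iota> T) \<cdot> t)"
    by (intro is_fiber_\<epsilon>_comp) simp_all
  then show "is_fiber C one (\<epsilon> \<cdot> \<mu> T) t (\<iota> (OMap S T) \<cdot> \<iota> T \<cdot> t)"
    by simp
  show "is_fiber C one (\<epsilon> \<cdot> AMap S \<epsilon>) t (\<iota> (OMap S T) \<cdot> \<iota> T \<cdot> t)"
    using is_fiber_\<epsilon>_S[OF is_fiber_\<epsilon>] by simp
qed simp

section \<open>Naturality of the multiplication and the monad laws\<close>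

lemma \<mu>_natural:
  assumes f: "f \<in> Arr C" "Dom C f = I" "Cod C f = J"
  shows "\<mu> J \<cdot> AMap S (AMap S f) = AMap S f \<cdot> \<mu> I"
proof (rule arr_eqI)
  have obj: "I \<in> Obj C" "J \<in> Obj C"
    using Dom_Cod_Obj[OF f(1)] f(2,3) by simp_all
  \<comment> \<open>Functoriality is read backwards: the two factors merge into T(e_J T(f)), to
    which naturality of \<open>e\<close> applies.\<close>
  have "AMap S (e J) \<cdot> AMap S (AMap S f) = AMap S (e I)"
    using f obj by (simp flip: S_simps(6))
  with f obj have e1: "e J \<cdot> \<mu> J \<cdot> AMap S (AMap S f) = \<epsilon> \<cdot> AMap S (e I)"
    by simp
  then show "e J \<cdot> \<mu> J \<cdot> AMap S (AMap S f) = e J \<cdot> AMap S f \<cdot> \<mu> I"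
    using f obj by simp
  show "is_fiber C one (e J \<cdot> \<mu> J \<cdot> AMap S (AMap S f)) t (\<iota> (OMap S I) \<cdot> \<iota> I)"
    unfolding e1 using is_fiber_\<epsilon>_S[OF is_fiber_e] obj by simp
  show "(\<mu> J \<cdot> AMap S (AMap S f)) \<cdot> \<iota> (OMap S I) \<cdot> \<iota> I = (AMap S f \<cdot> \<mu> I) \<cdot> \<iota> (OMap S I) \<cdot> \<iota> I"
    using f obj by simp
qed (use f Dom_Cod_Obj[OF f(1)] in auto)

text \<open>Since \<open>e I \<cdot> \<iota> I\<close> is constant at \<open>t\<close>, composing
  with \<open>e I\<close> gives chi_t T(t) T(!) = e_1 T(!) = e_I, where ! is the morphism from I to
  the terminal object.\<close>

lemma \<mu>_S_\<iota>:
  assumes I: "I \<in> Obj C"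
  shows "\<mu> I \<cdot> AMap S (\<iota> I) = Id C (OMap S I)"
proof (rule arr_eqI)
  have "AMap S (e I) \<cdot> AMap S (\<iota> I) = AMap S t \<cdot> AMap S (bang I)"
    using I by (simp flip: S_simps(6))
  with I have e1: "e I \<cdot> \<mu> I \<cdot> AMap S (\<iota> I) = e I"
    using comp_reassoc[OF \<epsilon>_S_t, of "AMap S (bang I)"] by simp
  then show "e I \<cdot> \<mu> I \<cdot> AMap S (\<iota> I) = e I \<cdot> Id C (OMap S I)"
    using I by simp
  show "is_fiber C one (e I \<cdot> \<mu> I \<cdot> AMap S (\<iota> I)) t (\<iota> I)"
    unfolding e1 using I by (rule is_fiber_e)
qed (use I in auto)

text \<open>Naturality of the unit at the arrow \<open>e I\<close> reduces the composite with
  \<open>e I\<close> to \<open>\<epsilon> \<cdot> \<iota> T \<cdot> e I\<close>.\<close>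

lemma \<mu>_\<iota>:
  assumes I: "I \<in> Obj C"
  shows "\<mu> I \<cdot> \<iota> (OMap S I) = Id C (OMap S I)"
proof (rule arr_eqI)
  have e1: "e I \<cdot> \<mu> I \<cdot> \<iota> (OMap S I) = e I"
    using I comp_reassoc[OF \<epsilon>_\<iota>, of "e I"] by simp
  then show "e I \<cdot> \<mu> I \<cdot> \<iota> (OMap S I) = e I \<cdot> Id C (OMap S I)"
    using I by simp
  show "is_fiber C one (e I \<cdot> \<mu> I \<cdot> \<iota> (OMap S I)) t (\<iota> I)"
    unfolding e1 using I by (rule is_fiber_e)
qed (use I in auto)

text \<open>Composed with \<open>e I\<close>, the left side becomes chi_t T(chi_t) TT(e_I). The
  right side becomes chi_t mu_T TT(e_I) by naturality of mu at \<open>e I\<close>, so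
  \<open>\<epsilon>_\<mu>\<close> equates them. Their common fiber is I, embedded by three
  successive units.\<close>

lemma \<mu>_assoc:
  assumes I: "I \<in> Obj C"
  shows "\<mu> I \<cdot> AMap S (\<mu> I) = \<mu> I \<cdot> \<mu> (OMap S I)"
proof (rule arr_eqI)
  let ?SSe = "AMap S (AMap S (e I))"
  have "AMap S (e I) \<cdot> AMap S (\<mu> I) = AMap S \<epsilon> \<cdot> ?SSe"
    using I by (simp flip: S_simps(6))
  with I have e1: "e I \<cdot> \<mu> I \<cdot> AMap S (\<mu> I) = \<epsilon> \<cdot> AMap S (\<epsilon> \<cdot> AMap S (e I))"
    by simp
  have "AMap S (e I) \<cdot> \<mu> (OMap S I) = \<mu> T \<cdot> ?SSe"
    using \<mu>_natural[of "e I"] I by simp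
  with I show "e I \<cdot> \<mu> I \<cdot> AMap S (\<mu> I) = e I \<cdot> \<mu> I \<cdot> \<mu> (OMap S I)"
    unfolding e1 using comp_reassoc[OF \<epsilon>_\<mu>, of ?SSe] by simp
  show "is_fiber C one (e I \<cdot> \<mu> I \<cdot> AMap S (\<mu> I)) t (\<iota> (OMap S (OMap S I)) \<cdot> \<iota> (OMap S I) \<cdot> \<iota> I)"
    unfolding e1 using is_fiber_\<epsilon>_S[OF is_fiber_\<epsilon>_S[OF is_fiber_e[OF I]]] I by simp
qed (use I in auto)

theorem is_monad: "is_monad C S \<iota> \<mu>"
proof -
  have "is_functor C C (comp_functor S S)"
    using S_functor by (simp add: is_functor_def comp_functor_def)
  then have "is_nat_trans C C (comp_functor S S) S \<mu>"
    using S_functor \<mu>_natural by (simp add: is_nat_trans_def comp_functor_def)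
  then show ?thesis
    unfolding is_monad_def using S_functor \<iota>_nat_trans \<mu>_assoc \<mu>_S_\<iota> \<mu>_\<iota> by blast
qed

end

section \<open>The universal property in a perfect operator category\<close>

locale perfect_cat = terminal_cat C one
  for C :: "('o, 'm) category" (structure) and one +
  fixes T :: 'o and t :: 'm and pr :: "'m \<Rightarrow> 'm"
    and E :: "('o, 'm, 'm, 'm \<times> 'm \<times> 'm) cfunctor" and \<kappa> :: "'o \<Rightarrow> 'm"
  assumes classifier: "point_classifier C one T t"
    and fiber_choice: "fiber_choice C one T t pr"
    and adjoint: "is_right_adjoint (slice C T) C (fib C pr) E \<kappa>"
begin

abbreviation S :: "('o, 'm, 'o, 'm) cfunctor" where
  "S \<equiv> T_functor C E"

abbreviation e :: "'o \<Rightarrow> 'm" where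
  "e \<equiv> OMap E"

abbreviation \<iota> :: "'o \<Rightarrow> 'm" where
  "\<iota> \<equiv> T_unit C pr E \<kappa>"

abbreviation \<epsilon> :: 'm where
  "\<epsilon> \<equiv> classifying C one T t (\<iota> T \<cdot> t)"

abbreviation \<mu> :: "'o \<Rightarrow> 'm" where
  "\<mu> \<equiv> T_mult C one T t pr E \<kappa>"

section \<open>Classifying morphisms and chosen fibers\<close>

lemma t_simps [simp]: "t \<in> Arr C" "Dom C t = one" "Cod C t = T"
  using classifier by (auto simp: point_classifier_def is_terminal_def pointed_def)

lemma T_Obj [simp]: "T \<in> Obj C"
  using Dom_Cod_Obj(2)[of t] by simp

lemma pointed_hom_iff:
  assumes "i \<in> Arr C" "Dom C i = one"
  shows "((Cod C i, i), f, (T, t)) \<in> hom (pointed C one) (Cod C i, i) (T, t) \<longleftrightarrow> is_fiber C one f t i"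
    (is "?lhs \<longleftrightarrow> ?rhs")
proof
  show ?rhs if ?lhs
    using that by (simp add: pointed_def hom_def)
  assume fib: ?rhs
  have "f \<cdot> i = t"
    using fiber_comm[OF fib] assms by simp
  then show ?lhs
    using fib is_fiber_arr[OF fib] assms by (simp add: pointed_def hom_def)
qed

lemma classified_ex1:
  assumes i: "i \<in> Arr C" "Dom C i = one"
  shows "\<exists>!f. is_fiber C one f t i"
proof -
  have "(Cod C i, i) \<in> Obj (pointed C one)"
    using i by (simp add: pointed_def)
  then have "\<exists>!a. a \<in> hom (pointed C one) (Cod C i, i) (T, t)"
    using classifier unfolding point_classifier_def is_terminal_def by blast
  moreover have "\<exists>f. a = ((Cod C i, i), f, (T, t))"
    if "a \<in> hom (pointed C one) (Cod C i, i) (T, t)" for a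
    using that by (auto simp: pointed_def hom_def)
  ultimately show ?thesis
    unfolding pointed_hom_iff[OF i, symmetric] by blast
qed

lemma is_fiber_classifying:
  assumes "i \<in> Arr C" "Dom C i = one"
  shows "is_fiber C one (classifying C one T t i) t i"
  unfolding classifying_def pointed_hom_iff[OF assms] by (rule theI') (rule classified_ex1[OF assms])

lemma is_fiber_pr:
  assumes "\<phi> \<in> Arr C" "Cod C \<phi> = T"
  shows "is_fiber C one \<phi> t (pr \<phi>)"
  using fiber_choice assms by (simp add: fiber_choice_def)

lemma pr_simps [simp]:
  assumes "\<phi> \<in> Arr C" "Cod C \<phi> = T"
  shows "pr \<phi> \<in> Arr C" "Cod C (pr \<phi>) = Dom C \<phi>"
  using is_fiber_arr[OF is_fiber_pr[OF assms]] by simp_all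

text \<open>A slice morphism with target \<open>\<psi>\<close> and underlying arrow \<open>f\<close>
  must have source \<open>\<psi> \<cdot> f\<close>, so these two arrows determine the
  triple.\<close>

abbreviation fib_map :: "'m \<Rightarrow> 'm \<Rightarrow> 'm" where
  "fib_map \<psi> f \<equiv> AMap (fib C pr) (\<psi> \<cdot> f, f, \<psi>)"

lemma fib_map:
  assumes f: "\<psi> \<in> Arr C" "Cod C \<psi> = T" "f \<in> Arr C" "Cod C f = Dom C \<psi>"
  shows "fib_map \<psi> f \<in> Arr C" "Dom C (fib_map \<psi> f) = Dom C (pr (\<psi> \<cdot> f))"
    "Cod C (fib_map \<psi> f) = Dom C (pr \<psi>)" "pr \<psi> \<cdot> fib_map \<psi> f = f \<cdot> pr (\<psi> \<cdot> f)"
proof -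
  let ?P = "\<lambda>g. g \<in> hom C (Dom C (pr (\<psi> \<cdot> f))) (Dom C (pr \<psi>)) \<and> pr \<psi> \<cdot> g = f \<cdot> pr (\<psi> \<cdot> f)"
  have fib: "is_fiber C one \<psi> t (pr \<psi>)" "is_fiber C one (\<psi> \<cdot> f) t (pr (\<psi> \<cdot> f))"
    using f by (simp_all add: is_fiber_pr)
  have "\<psi> \<cdot> f \<cdot> pr (\<psi> \<cdot> f) = t \<cdot> bang (Dom C (pr (\<psi> \<cdot> f)))"
    using fiber_comm[OF fib(2)] f by simp
  then obtain g where "g \<in> Arr C" "Dom C g = Dom C (pr (\<psi> \<cdot> f))" "Cod C g = Dom C (pr \<psi>)"
    "pr \<psi> \<cdot> g = f \<cdot> pr (\<psi> \<cdot> f)"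
    using fiber_lift[OF fib(1), of "f \<cdot> pr (\<psi> \<cdot> f)"] f by auto
  then have g: "?P g"
    by simp
  have uniq: "g' = g" if "?P g'" for g'
    by (rule fiber_mono[OF fib(1)]) (use that g in simp_all)
  have "?P (THE g. ?P g)"
    by (rule theI[of ?P, OF g uniq])
  moreover have "fib_map \<psi> f = (THE g. ?P g)"
    by (simp add: fib_def)
  ultimately have "?P (fib_map \<psi> f)"
    by (simp only:)
  then show "fib_map \<psi> f \<in> Arr C" "Dom C (fib_map \<psi> f) = Dom C (pr (\<psi> \<cdot> f))"
    "Cod C (fib_map \<psi> f) = Dom C (pr \<psi>)" "pr \<psi> \<cdot> fib_map \<psi> f = f \<cdot> pr (\<psi> \<cdot> f)"
    by simp_all
qed

section \<open>The adjunction in terms of underlying arrows\<close>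

lemma E_functor: "is_functor C (slice C T) E"
  and \<kappa>_nat_trans: "is_nat_trans C C (comp_functor (fib C pr) E) id_functor \<kappa>"
  and adjoint_bij: "\<phi> \<in> Arr C \<Longrightarrow> Cod C \<phi> = T \<Longrightarrow> I \<in> Obj C \<Longrightarrow>
    bij_betw (\<lambda>g. \<kappa> I \<cdot> AMap (fib C pr) g) (hom (slice C T) \<phi> (e I)) (hom C (Dom C (pr \<phi>)) I)"
proof -
  note adj = adjoint[unfolded is_right_adjoint_def]
  show "is_functor C (slice C T) E" "is_nat_trans C C (comp_functor (fib C pr) E) id_functor \<kappa>"
    using adj by blast+
  assume "\<phi> \<in> Arr C" "Cod C \<phi> = T" "I \<in> Obj C"
  then have "\<phi> \<in> Obj (slice C T)" "OMap (fib C pr) \<phi> = Dom C (pr \<phi>)"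
    by (simp_all add: fib_def)
  with adj \<open>I \<in> Obj C\<close> show
    "bij_betw (\<lambda>g. \<kappa> I \<cdot> AMap (fib C pr) g) (hom (slice C T) \<phi> (e I)) (hom C (Dom C (pr \<phi>)) I)"
    by metis
qed

lemma e_simps [simp]:
  assumes "I \<in> Obj C"
  shows "e I \<in> Arr C" "Cod C (e I) = T"
  using E_functor assms by (simp_all add: is_functor_def)

lemma Dom_e [simp]: "Dom C (e I) = OMap S I"
  by (simp add: T_functor_def forget_def comp_functor_def)

lemma E_map:
  assumes f: "f \<in> Arr C"
  shows "AMap E f = (e (Dom C f), AMap S f, e (Cod C f))"
    and "AMap S f \<in> Arr C" "Dom C (AMap S f) = OMap S (Dom C f)"
      "Cod C (AMap S f) = OMap S (Cod C f)"
    and "e (Cod C f) \<cdot> AMap S f = e (Dom C f)"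
proof -
  have "\<forall>f\<in>Arr C. AMap E f \<in> hom (slice C T) (e (Dom C f)) (e (Cod C f))"
    using E_functor unfolding is_functor_def by (elim conjE)
  with f have "AMap E f \<in> hom (slice C T) (e (Dom C f)) (e (Cod C f))"
    by (rule bspec[rotated])
  then obtain g where g: "AMap E f = (e (Dom C f), g, e (Cod C f))" "g \<in> Arr C"
    "Dom C g = Dom C (e (Dom C f))" "Cod C g = Dom C (e (Cod C f))" "e (Cod C f) \<cdot> g = e (Dom C f)"
    by (rule slice_homE)
  have S_f: "AMap S f = g"
    by (simp add: T_functor_def forget_def comp_functor_def g(1) del: Dom_e)
  show "AMap E f = (e (Dom C f), AMap S f, e (Cod C f))"
    unfolding S_f by (rule g(1))
  show "AMap S f \<in> Arr C" "Dom C (AMap S f) = OMap S (Dom C f)"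
      "Cod C (AMap S f) = OMap S (Cod C f)" "e (Cod C f) \<cdot> AMap S f = e (Dom C f)"
    unfolding S_f using g(2-5) unfolding Dom_e .
qed

lemma S_Obj [simp]: "I \<in> Obj C \<Longrightarrow> OMap S I \<in> Obj C"
  using Dom_Cod_Obj(1)[of "e I"] by simp

lemma S_functor: "is_functor C C S"
  unfolding is_functor_def
proof (intro conjI ballI impI)
  fix f g assume fg: "f \<in> Arr C" "g \<in> Arr C" "Cod C f = Dom C g"
  then have "AMap E (g \<cdot> f) = Comp (slice C T) (AMap E g) (AMap E f)"
    using E_functor by (simp add: is_functor_def)
  then show "AMap S (g \<cdot> f) = AMap S g \<cdot> AMap S f"
    using fg by (simp add: E_map(1) slice_def)
next
  fix a assume a: "a \<in> Obj C"
  then have "AMap E (Id C a) = Id (slice C T) (e a)"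
    using E_functor by (simp add: is_functor_def)
  then show "AMap S (Id C a) = Id C (OMap S a)"
    using a by (simp add: E_map(1) slice_def)
qed (simp_all add: is_category E_map(2-4))

lemma \<kappa>_simps [simp]:
  assumes "I \<in> Obj C"
  shows "\<kappa> I \<in> Arr C" "Dom C (\<kappa> I) = Dom C (pr (e I))" "Cod C (\<kappa> I) = I"
  using \<kappa>_nat_trans assms by (simp_all add: is_nat_trans_def comp_functor_def id_functor_def fib_def)

lemma \<kappa>_natural:
  assumes "f \<in> Arr C"
  shows "\<kappa> (Cod C f) \<cdot> fib_map (e (Cod C f)) (AMap S f) = f \<cdot> \<kappa> (Dom C f)"
  using \<kappa>_nat_trans assms
  by (simp add: is_nat_trans_def comp_functor_def id_functor_def E_map(1,5))

lemma adjoint_inj: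
  assumes "I \<in> Obj C" "g \<in> hom C J (OMap S I)" "h \<in> hom C J (OMap S I)"
    and "e I \<cdot> g = e I \<cdot> h" "\<kappa> I \<cdot> fib_map (e I) g = \<kappa> I \<cdot> fib_map (e I) h"
  shows "g = h"
proof -
  have "(e I \<cdot> g, g, e I) = (e I \<cdot> h, h, e I)"
    by (rule inj_onD[OF bij_betw_imp_inj_on[OF adjoint_bij[of "e I \<cdot> g" I]]]) (use assms in simp_all)
  then show ?thesis
    by simp
qed

lemma adjunct_props:
  assumes "\<phi> \<in> Arr C" "Cod C \<phi> = T" "I \<in> Obj C" "f \<in> hom C (Dom C (pr \<phi>)) I"
  obtains g where "adjunct (slice C T) C (fib C pr) E \<kappa> \<phi> I f = (\<phi>, g, e I)"
    "g \<in> Arr C" "Dom C g = Dom C \<phi>" "Cod C g = OMap S I" "e I \<cdot> g = \<phi>" "\<kappa> I \<cdot> fib_map (e I) g = f"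
proof -
  let ?A = "hom (slice C T) \<phi> (e I)" and ?F = "\<lambda>g. \<kappa> I \<cdot> AMap (fib C pr) g"
  note bij = adjoint_bij[OF assms(1-3)]
  have "f \<in> ?F ` ?A"
    unfolding bij_betw_imp_surj_on[OF bij] by (rule assms(4))
  then obtain a where a: "f = ?F a" "a \<in> ?A"
    by (rule imageE)
  have adjunct_eq: "adjunct (slice C T) C (fib C pr) E \<kappa> \<phi> I f = a"
    unfolding adjunct_def
  proof (rule the_equality)
    fix a' assume "a' \<in> ?A \<and> ?F a' = f"
    with a show "a' = a"
      by (intro inj_onD[OF bij_betw_imp_inj_on[OF bij], of a' a]) simp_all
  qed (simp add: a)
  from a(2) obtain g where g: "a = (\<phi>, g, e I)" "g \<in> Arr C" "Dom C g = Dom C \<phi>"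
    "Cod C g = Dom C (e I)" "e I \<cdot> g = \<phi>"
    by (rule slice_homE)
  have "\<kappa> I \<cdot> fib_map (e I) g = f"
    unfolding g(5) a(1) g(1) ..
  with adjunct_eq g show thesis
    by (intro that[of g]) simp_all
qed

text \<open>The functor \<open>I \<mapsto> (I \<rightarrow> 1 \<rightarrow> T)\<close> is a fully faithful left adjoint of \<open>fib\<close>, and therefore the
  right adjoint \<open>E\<close> of \<open>fib\<close> is fully faithful as well.\<close>

lemma \<kappa>_iso:
  assumes I: "I \<in> Obj C"
  obtains k where "k \<in> Arr C" "Dom C k = I" "Cod C k = Dom C (pr (e I))"
    "\<kappa> I \<cdot> k = Id C I" "k \<cdot> \<kappa> I = Id C (Dom C (pr (e I)))"
proof -
  \<comment> \<open>The fiber of a constant morphism is its whole source, so the chosen fiber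
    inclusion has a section \<open>w\<close>.\<close>
  have pr_const: thesis
    if J: "J \<in> Obj C"
      and thesis: "\<And>w. w \<in> Arr C \<Longrightarrow> Dom C w = J \<Longrightarrow> Cod C w = Dom C (pr (t \<cdot> bang J)) \<Longrightarrow>
        pr (t \<cdot> bang J) \<cdot> w = Id C J \<Longrightarrow> thesis" for J thesis
  proof -
    have "is_fiber C one (t \<cdot> bang J) t (pr (t \<cdot> bang J))"
      using J by (intro is_fiber_pr) simp_all
    from fiber_lift[OF this, of "Id C J"] J that show ?thesis
      by auto
  qed
  let ?D = "Dom C (pr (e I))" and ?p = "pr (e I)" and ?r = "pr (t \<cdot> bang I)"
  have p: "is_fiber C one (e I) t ?p"
    using I by (simp add: is_fiber_pr)
  have p_arr: "?p \<in> Arr C" "Cod C ?p = OMap S I"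
    using I by simp_all
  then have D: "?D \<in> Obj C"
    by simp
  have r: "?r \<in> Arr C" "Cod C ?r = I"
    using I by simp_all
  have "?r \<in> hom C (Dom C ?r) I"
    using r by simp
  \<comment> \<open>Up to the identification of I with the fiber of its constant morphism,
    \<open>g\<close> is the transpose of the identity of I. It lies over a constant morphism, so it
    factors through \<open>?p\<close>, and the factor \<open>k\<close> is the candidate inverse of
    kappa.\<close>
  then obtain g where g: "g \<in> Arr C" "Dom C g = I" "Cod C g = OMap S I" "e I \<cdot> g = t \<cdot> bang I"
    "\<kappa> I \<cdot> fib_map (e I) g = ?r"
    using adjunct_props[of "t \<cdot> bang I" I ?r] I by auto
  obtain k where k: "k \<in> Arr C" "Dom C k = I" "Cod C k = ?D" "?p \<cdot> k = g"
    using fiber_lift[OF p, of g] g by auto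
  have fib_g: "fib_map (e I) g = k \<cdot> ?r"
  proof (rule fiber_mono[OF p])
    show "?p \<cdot> fib_map (e I) g = ?p \<cdot> k \<cdot> ?r"
      using comp_reassoc[OF k(4), of ?r] k(1-3) p_arr r g(1-4) I fib_map(4)[of "e I" g] by simp
  qed (use fib_map(1-3)[of "e I" g] I g(1-4) k(1-3) r in simp_all)
  obtain w where w: "w \<in> Arr C" "Dom C w = I" "Cod C w = Dom C ?r" "?r \<cdot> w = Id C I"
    using pr_const[OF I] by blast
  \<comment> \<open>This is the transposition equation of \<open>g\<close>; the section
    \<open>w\<close> then cancels \<open>?r\<close>.\<close>
  have "(\<kappa> I \<cdot> k) \<cdot> ?r = ?r"
    using g(5) k(1-3) r I unfolding fib_g by simp
  then have "((\<kappa> I \<cdot> k) \<cdot> ?r) \<cdot> w = ?r \<cdot> w"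
    by simp
  then have \<kappa>k: "\<kappa> I \<cdot> k = Id C I"
    using k(1-3) r w I by simp
  \<comment> \<open>The other composite is compared after the monic \<open>?p\<close>. Both sides
    then lie over the constant morphism on \<open>?D\<close>, so it suffices to compare transposes:
    fib sends them to \<open>?s\<close> and \<open>k \<cdot> \<kappa> I \<cdot> ?s\<close>, which
    agree after \<open>\<kappa> I\<close> because \<open>k\<close> is a section of it.\<close>
  have "?p = ?p \<cdot> k \<cdot> \<kappa> I"
  proof (rule adjoint_inj[OF I])
    let ?s = "pr (t \<cdot> bang ?D)"
    have ep: "e I \<cdot> ?p = t \<cdot> bang ?D"
      using fiber_comm[OF p] .
    have epk: "e I \<cdot> ?p \<cdot> k \<cdot> \<kappa> I = t \<cdot> bang ?D"
      using comp_reassoc[OF ep, of "k \<cdot> \<kappa> I"] k(1-3) p_arr I D by simp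
    show "e I \<cdot> ?p = e I \<cdot> ?p \<cdot> k \<cdot> \<kappa> I"
      by (simp only: ep epk)
    have s: "?s \<in> Arr C" "Cod C ?s = ?D"
      using D by simp_all
    have "fib_map (e I) ?p = ?s"
    proof (rule fiber_mono[OF p])
      show "?p \<cdot> fib_map (e I) ?p = ?p \<cdot> ?s"
        using fib_map(4)[of "e I" ?p] p_arr I unfolding ep by simp
    qed (use fib_map(1-3)[of "e I" ?p] ep I p_arr s in simp_all)
    moreover have "fib_map (e I) (?p \<cdot> k \<cdot> \<kappa> I) = k \<cdot> \<kappa> I \<cdot> ?s"
    proof (rule fiber_mono[OF p])
      show "?p \<cdot> fib_map (e I) (?p \<cdot> k \<cdot> \<kappa> I) = ?p \<cdot> k \<cdot> \<kappa> I \<cdot> ?s"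
        using fib_map(4)[of "e I" "?p \<cdot> k \<cdot> \<kappa> I"] k(1-3) p_arr s I unfolding epk by simp
    qed (use fib_map(1-3)[of "e I" "?p \<cdot> k \<cdot> \<kappa> I"] epk I p_arr s k(1-3) in simp_all)
    moreover have "\<kappa> I \<cdot> k \<cdot> \<kappa> I \<cdot> ?s = \<kappa> I \<cdot> ?s"
      using comp_reassoc[OF \<kappa>k, of "\<kappa> I \<cdot> ?s"] k(1-3) s I by simp
    ultimately show "\<kappa> I \<cdot> fib_map (e I) ?p = \<kappa> I \<cdot> fib_map (e I) (?p \<cdot> k \<cdot> \<kappa> I)"
      by simp
  qed (use k(1-3) p_arr I in simp_all)
  from this[symmetric] have "k \<cdot> \<kappa> I = Id C ?D"
    using k(1-3) p_arr D I fiber_mono[OF p, of "k \<cdot> \<kappa> I" "Id C ?D"] by simp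
  with k(1-3) \<kappa>k show thesis
    by (rule that)
qed

text \<open>Fibers may be transported along isomorphisms, here the inverse of kappa. Henceforth the
  unit replaces the chosen fiber of \<open>e I\<close>.\<close>

lemma
  assumes I: "I \<in> Obj C"
  shows is_fiber_e: "is_fiber C one (e I) t (\<iota> I)"
    and \<iota>_hom: "\<iota> I \<in> hom C I (OMap S I)"
    and \<iota>_\<kappa>: "\<iota> I \<cdot> \<kappa> I = pr (e I)"
proof -
  obtain k where k: "k \<in> Arr C" "Dom C k = I" "Cod C k = Dom C (pr (e I))"
    "\<kappa> I \<cdot> k = Id C I" "k \<cdot> \<kappa> I = Id C (Dom C (pr (e I)))"
    using \<kappa>_iso[OF I] by blast
  have p: "is_fiber C one (e I) t (pr (e I))"
    using I by (simp add: is_fiber_pr)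
  have "arr_inverse C (\<kappa> I) = k"
    by (rule arr_inverse_eq) (use k I in simp_all)
  then have \<iota>: "\<iota> I = pr (e I) \<cdot> k"
    by (simp add: T_unit_def)
  show "is_fiber C one (e I) t (\<iota> I)"
    unfolding \<iota> by (rule is_fiber_iso[OF p, of k "\<kappa> I"]) (use k I in simp_all)
  show "\<iota> I \<in> hom C I (OMap S I)"
    unfolding \<iota> using k(1-3) I by simp
  show "\<iota> I \<cdot> \<kappa> I = pr (e I)"
    unfolding \<iota> using k I by simp
qed

lemma \<iota>_simps [simp]:
  assumes "I \<in> Obj C"
  shows "\<iota> I \<in> Arr C" "Dom C (\<iota> I) = I" "Cod C (\<iota> I) = OMap S I"
  using \<iota>_hom[OF assms] by simp_all

text \<open>It reads the transpose of \<open>g\<close> as the restriction of \<open>g\<close> to the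
  fiber of \<open>e I \<cdot> g\<close>, with values in I inside TI.\<close>

lemma comp_pr:
  assumes "I \<in> Obj C" "g \<in> Arr C" "Cod C g = OMap S I"
  shows "g \<cdot> pr (e I \<cdot> g) = \<iota> I \<cdot> \<kappa> I \<cdot> fib_map (e I) g"
proof -
  note fm = fib_map[of "e I" g]
  have "g \<cdot> pr (e I \<cdot> g) = pr (e I) \<cdot> fib_map (e I) g"
    using fm(4) assms by simp
  also have "\<dots> = \<iota> I \<cdot> \<kappa> I \<cdot> fib_map (e I) g"
    using fm(1-3) assms by (intro comp_reassoc[OF \<iota>_\<kappa>, symmetric]) simp_all
  finally show ?thesis .
qed

lemma \<iota>_natural:
  assumes f: "f \<in> Arr C"
  shows "\<iota> (Cod C f) \<cdot> f = AMap S f \<cdot> \<iota> (Dom C f)"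
proof -
  let ?I = "Dom C f" and ?J = "Cod C f"
  obtain k where k: "k \<in> Arr C" "Dom C k = ?I" "Cod C k = Dom C (pr (e ?I))" "\<kappa> ?I \<cdot> k = Id C ?I"
    using \<kappa>_iso[of ?I] f by auto
  \<comment> \<open>The naturality square precomposed with kappa: the restriction of T(f) to the
    chosen fiber is computed by naturality of kappa, and \<open>k\<close> then cancels
    kappa.\<close>
  have "AMap S f \<cdot> \<iota> ?I \<cdot> \<kappa> ?I = \<iota> ?J \<cdot> f \<cdot> \<kappa> ?I"
    using comp_pr[of ?J "AMap S f"] f \<kappa>_natural[OF f] \<iota>_\<kappa>[of ?I] by (simp add: E_map)
  then have "(AMap S f \<cdot> \<iota> ?I \<cdot> \<kappa> ?I) \<cdot> k = (\<iota> ?J \<cdot> f \<cdot> \<kappa> ?I) \<cdot> k"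
    by simp
  then show ?thesis
    using f k E_map(2-4)[OF f] by simp
qed

text \<open>Agreement on one fiber passes to the chosen one through the comparison
  \<open>\<theta>\<close>. There \<open>comp_pr\<close> and monicity of the unit turn it into
  equality of transposes.\<close>

lemma arr_eqI:
  assumes I: "I \<in> Obj C" and g: "g \<in> hom C J (OMap S I)" and h: "h \<in> hom C J (OMap S I)"
    and eq: "e I \<cdot> g = e I \<cdot> h" and p: "is_fiber C one (e I \<cdot> g) t p" "g \<cdot> p = h \<cdot> p"
  shows "g = h"
proof (rule adjoint_inj[OF I g h eq])
  let ?q = "pr (e I \<cdot> g)"
  have q: "is_fiber C one (e I \<cdot> g) t ?q"
    using I g by (intro is_fiber_pr) simp_all
  obtain \<theta> where \<theta>: "\<theta> \<in> Arr C" "Dom C \<theta> = Dom C ?q" "Cod C \<theta> = Dom C p" "p \<cdot> \<theta> = ?q"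
    using fiber_iso_unique[OF q p(1)] by metis
  have p_arr: "p \<in> Arr C" "Cod C p = J"
    using is_fiber_arr[OF p(1)] I g by simp_all
  have "(g \<cdot> p) \<cdot> \<theta> = (h \<cdot> p) \<cdot> \<theta>"
    by (simp only: p(2))
  then have "g \<cdot> ?q = h \<cdot> ?q"
    using \<theta> p_arr g h by simp
  then have eq': "\<iota> I \<cdot> \<kappa> I \<cdot> fib_map (e I) g = \<iota> I \<cdot> \<kappa> I \<cdot> fib_map (e I) h"
    using comp_pr[of I g] comp_pr[of I h] I g h eq by simp
  show "\<kappa> I \<cdot> fib_map (e I) g = \<kappa> I \<cdot> fib_map (e I) h"
    by (rule fiber_mono[OF is_fiber_e[OF I] _ _ _ _ _ eq'])
      (use fib_map(1-3)[of "e I" g] fib_map(1-3)[of "e I" h] I g h eq in simp_all)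
qed

sublocale partial_map_functor C one T t S e \<iota> \<epsilon>
proof
  show "is_nat_trans C C id_functor S \<iota>"
    using S_functor \<iota>_natural is_category
    by (simp add: is_nat_trans_def id_functor_def is_functor_def)
  show "f = g" if "is_fiber C one f t i" "is_fiber C one g t i" "Dom C i = one" for f g i
    using classified_ex1[of i] that is_fiber_arr(5)[OF that(1)] by blast
  show "is_fiber C one \<epsilon> t (\<iota> T \<cdot> t)"
    by (rule is_fiber_classifying) simp_all
  show "g = h" if "I \<in> Obj C" "g \<in> hom C J (OMap S I)" "h \<in> hom C J (OMap S I)"
    "e I \<cdot> g = e I \<cdot> h" "is_fiber C one (e I \<cdot> g) t p" "g \<cdot> p = h \<cdot> p" for I g h J p
    using that by (rule arr_eqI)
qed (simp_all add: S_functor E_map(5) is_fiber_e)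

section \<open>The morphism sigma and the multiplication\<close>

lemma \<sigma>_props:
  assumes \<phi>: "\<phi> \<in> Arr C" "Cod C \<phi> = T"
  defines "\<sigma> \<equiv> T_sigma C one T t pr E \<kappa> \<phi>"
  shows "\<sigma> \<in> Arr C" "Dom C \<sigma> = OMap S (Dom C \<phi>)" "Cod C \<sigma> = OMap S (Dom C (pr \<phi>))"
    and "e (Dom C (pr \<phi>)) \<cdot> \<sigma> = \<epsilon> \<cdot> AMap S \<phi>"
    and "\<sigma> \<cdot> \<iota> (Dom C \<phi>) \<cdot> pr \<phi> = \<iota> (Dom C (pr \<phi>))"
proof -
  let ?J = "Dom C \<phi>" and ?F = "Dom C (pr \<phi>)" and ?c = "\<epsilon> \<cdot> AMap S \<phi>"
  have obj: "?J \<in> Obj C" "?F \<in> Obj C"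
    using \<phi> Dom_Cod_Obj(1)[of "pr \<phi>"] by simp_all
  have c: "T_chi C one T t pr E \<kappa> \<phi> = ?c"
    by (simp add: T_chi_def)
  have c_arr: "?c \<in> Arr C" "Dom C ?c = OMap S ?J" "Cod C ?c = T"
    using \<phi> by simp_all
  have fib: "is_fiber C one ?c t (\<iota> ?J \<cdot> pr \<phi>)" and fib': "is_fiber C one ?c t (pr ?c)"
    using is_fiber_\<epsilon>_S[OF is_fiber_pr[OF \<phi>]] is_fiber_pr[OF c_arr(1,3)] .
  have Dom_fib: "Dom C (\<iota> ?J \<cdot> pr \<phi>) = ?F"
    using \<phi> obj by simp
  obtain \<theta> \<theta>' where \<theta>: "\<theta> \<in> Arr C" "Dom C \<theta> = Dom C (pr ?c)" "Cod C \<theta> = ?F" "(\<iota> ?J \<cdot> pr \<phi>) \<cdot> \<theta> = pr ?c"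
    and \<theta>': "\<theta>' \<in> Arr C" "Dom C \<theta>' = ?F" "Cod C \<theta>' = Dom C (pr ?c)" "\<theta> \<cdot> \<theta>' = Id C ?F"
    using fiber_iso_unique[OF fib' fib] unfolding Dom_fib by blast
  \<comment> \<open>Existence comes from two fibers of the same morphism being isomorphic,
    uniqueness from \<open>\<iota> ?J \<cdot> pr \<phi>\<close> being monic.\<close>
  have "T_ident C one T t pr E \<kappa> \<phi> = \<theta>"
    unfolding T_ident_def c
  proof (rule the_equality)
    show "\<theta> \<in> hom C (Dom C (pr ?c)) ?F \<and> \<iota> ?J \<cdot> pr \<phi> \<cdot> \<theta> = pr ?c"
      using \<theta> \<phi> obj by simp
    fix \<theta>2 assume \<theta>2: "\<theta>2 \<in> hom C (Dom C (pr ?c)) ?F \<and> \<iota> ?J \<cdot> pr \<phi> \<cdot> \<theta>2 = pr ?c"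
    show "\<theta>2 = \<theta>"
      by (rule fiber_mono[OF fib]) (use \<theta>2 \<theta> \<phi> obj in simp_all)
  qed
  then have \<sigma>_def': "\<sigma> = AMap (forget C) (adjunct (slice C T) C (fib C pr) E \<kappa> ?c ?F \<theta>)"
    unfolding \<sigma>_def T_sigma_def c by (simp add: fib_def)
  have "\<theta> \<in> hom C (Dom C (pr ?c)) ?F"
    using \<theta> by simp
  then obtain g where g: "adjunct (slice C T) C (fib C pr) E \<kappa> ?c ?F \<theta> = (?c, g, e ?F)"
    "g \<in> Arr C" "Dom C g = Dom C ?c" "Cod C g = OMap S ?F" "e ?F \<cdot> g = ?c" "\<kappa> ?F \<cdot> fib_map (e ?F) g = \<theta>"
    using adjunct_props[OF c_arr(1,3) obj(2)] by blast
  have "\<sigma> = g"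
    by (simp add: \<sigma>_def' g(1) forget_def)
  then show \<sigma>: "\<sigma> \<in> Arr C" "Dom C \<sigma> = OMap S ?J" "Cod C \<sigma> = OMap S ?F" "e ?F \<cdot> \<sigma> = ?c"
    using g(2-5) c_arr(2) by simp_all
  \<comment> \<open>The transposition equation, read as a restriction to the chosen fiber. That
    fiber inclusion is \<open>\<iota> ?J \<cdot> pr \<phi>\<close> followed backwards by
    \<open>\<theta>\<close>, so the right inverse \<open>\<theta>'\<close> removes
    \<open>\<theta>\<close> from both sides.\<close>
  have "\<sigma> \<cdot> pr ?c = \<iota> ?F \<cdot> \<theta>"
    using comp_pr[OF obj(2) g(2,4)] unfolding g(6) unfolding g(5) \<open>\<sigma> = g\<close> .
  then have "(\<sigma> \<cdot> (\<iota> ?J \<cdot> pr \<phi>) \<cdot> \<theta>) \<cdot> \<theta>' = (\<iota> ?F \<cdot> \<theta>) \<cdot> \<theta>'"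
    unfolding \<theta>(4) by simp
  then show "\<sigma> \<cdot> \<iota> ?J \<cdot> pr \<phi> = \<iota> ?F"
    using \<sigma>(1-3) \<theta>(1-3) \<theta>' \<phi> obj by simp
qed

text \<open>T(kappa_I) is a morphism over T, so mu inherits its composite with \<open>e I\<close>
  from sigma. On the fiber, naturality of the unit moves T(kappa_I) past \<open>\<iota> ?F\<close>,
  leaving kappa_I to cancel against its inverse.\<close>

sublocale partial_map_mult C one T t S e \<iota> \<epsilon> \<mu>
proof
  fix I assume I: "I \<in> Obj C"
  let ?\<sigma> = "T_sigma C one T t pr E \<kappa> (e I)" and ?F = "Dom C (pr (e I))"
  have \<mu>: "\<mu> I = AMap S (\<kappa> I) \<cdot> ?\<sigma>"
    by (simp add: T_mult_def)
  have \<sigma>: "?\<sigma> \<in> Arr C" "Dom C ?\<sigma> = OMap S (OMap S I)" "Cod C ?\<sigma> = OMap S ?F"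
    "e ?F \<cdot> ?\<sigma> = \<epsilon> \<cdot> AMap S (e I)" "?\<sigma> \<cdot> \<iota> (OMap S I) \<cdot> pr (e I) = \<iota> ?F"
    using \<sigma>_props[of "e I"] I by simp_all
  show "\<mu> I \<in> hom C (OMap S (OMap S I)) (OMap S I)"
    using \<sigma>(1-3) I by (simp add: \<mu>)
  show "e I \<cdot> \<mu> I = \<epsilon> \<cdot> AMap S (e I)"
    using \<sigma>(1-4) I by (simp add: \<mu>)
  obtain k where k: "k \<in> Arr C" "Dom C k = I" "Cod C k = ?F" "\<kappa> I \<cdot> k = Id C I"
    using \<kappa>_iso[OF I] by blast
  have "\<iota> I = \<iota> I \<cdot> \<kappa> I \<cdot> k"
    using k I by simp
  also have "\<dots> = pr (e I) \<cdot> k"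
    by (rule comp_reassoc[OF \<iota>_\<kappa>[OF I]]) (use k I in simp_all)
  finally have \<iota>: "\<iota> I = pr (e I) \<cdot> k" .
  have "?\<sigma> \<cdot> \<iota> (OMap S I) \<cdot> pr (e I) \<cdot> k = \<iota> ?F \<cdot> k"
    using comp_reassoc[OF \<sigma>(5), of k] \<sigma>(1-3) k(1-3) I by simp
  then have "\<mu> I \<cdot> \<iota> (OMap S I) \<cdot> pr (e I) \<cdot> k = AMap S (\<kappa> I) \<cdot> \<iota> ?F \<cdot> k"
    using \<sigma>(1-3) k(1-3) I by (simp add: \<mu>)
  also have "\<dots> = \<iota> I"
    using k I by simp
  finally show "\<mu> I \<cdot> \<iota> (OMap S I) \<cdot> \<iota> I = \<iota> I"
    by (simp only: \<iota>)
qed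

end

theorem theorem5p10:
  fixes Phi :: "('o, 'm) category" and one T :: 'o and t :: 'm and pr :: "'m \<Rightarrow> 'm"
    and E :: "('o, 'm, 'm, 'm \<times> 'm \<times> 'm) cfunctor" and \<kappa> :: "'o \<Rightarrow> 'm"
  assumes "operator_category Phi one"
    and "perfect Phi one"
    and "point_classifier Phi one T t"
    and "fiber_choice Phi one T t pr"
    and "is_right_adjoint (slice Phi T) Phi (fib Phi pr) E \<kappa>"
  shows "is_monad Phi (T_functor Phi E)
           (T_unit Phi pr E \<kappa>) (T_mult Phi one T t pr E \<kappa>)"
proof -
  interpret perfect_cat Phi one T t pr E \<kappa>
    by unfold_locales (use assms in \<open>simp_all add: operator_category_def\<close>)
  show ?thesis
    by (rule is_monad)
qed

end
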